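(* Let $(X,C)$ be a finite separable convexity space. \begin{enumerate} \item If the Radon number of $(X,C)$ is at most $r$, then for every $\varepsilon>0$, $(X,C)$ has weak $\varepsilon$-nets of size at most $(120 r^2/\varepsilon)^{4r^2\ln(1/\varepsilon)}$; that is, for every probability distribution $\mu$ on $X$ there is a weak $\varepsilon$-net for $C$ over $\mu$ of at most that size. \item If the Radon number of $(X,C)$ is more than $r$, then there is a probability distribution $\mu$ over $X$ such that every weak $\frac14$-net for $C$ over $\mu$ has size at least $r/2$. \end{enumerate}
   Context: A convexity space is a pair $(X,C)$ with $C\subseteq 2^X$ such that $\emptyset, X\in C$ and $C$ is closed under arbitrary intersections ($\bigcap_{c\in C'}c\in C$ for every $C'\subseteq C$). Members of $C$ are convex sets. The convex hull $conv(Y)$ of $Y\subseteq X$ is the intersection of all $c\in C$ containing $Y$. A half-space is a $b\in C$ whose complement $X\setminus b$ is also in $C$. $(X,C)$ is separable if for every $c\in C$ and $x\in X\setminus c$ there is a half-space $b$ with $c\subseteq b$ and $x\notin b$. $C$ Radon-shatters $Y\subseteq X$ if for every partition of $Y$ into two parts $Y_1,Y_2$ one has $conv(Y_1)\cap conv(Y_2)=\emptyset$. The Radon number of $(X,C)$ is the minimum $r$ such that $C$ does not Radon-shatter any set of size $r$. For a probability distribution $\mu$ on $X$ (all sets considered are assumed measurable), a set $S\subseteq X$ is a weak $\varepsilon$-net for $C$ over $\mu$ if $S\cap c\neq\emptyset$ for every $c\in C$ with $\mu(c)\ge\varepsilon$. *)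

theory Defs
  imports "HOL-Probability.Probability"
begin

text \<open>A convexity space on the ground set X with family of convex sets C.
  Closure under intersections is required for nonempty subfamilies; the empty
  intersection is X by convention (and X is in C).\<close>
definition convexity_space :: "'a set \<Rightarrow> 'a set set \<Rightarrow> bool" where
  "convexity_space X C \<longleftrightarrow> C \<subseteq> Pow X \<and> {} \<in> C \<and> X \<in> C \<and>
     (\<forall>C'. C' \<subseteq> C \<and> C' \<noteq> {} \<longrightarrow> \<Inter>C' \<in> C)"

definition cconv :: "'a set set \<Rightarrow> 'a set \<Rightarrow> 'a set" where
  "cconv C Y = \<Inter>{c \<in> C. Y \<subseteq> c}"

definition half_space :: "'a set \<Rightarrow> 'a set set \<Rightarrow> 'a set \<Rightarrow> bool" where
  "half_space X C b \<longleftrightarrow> b \<in> C \<and> X - b \<in> C"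

definition separable :: "'a set \<Rightarrow> 'a set set \<Rightarrow> bool" where
  "separable X C \<longleftrightarrow> (\<forall>c \<in> C. \<forall>x \<in> X - c. \<exists>b. half_space X C b \<and> c \<subseteq> b \<and> x \<notin> b)"

definition radon_shatters :: "'a set set \<Rightarrow> 'a set \<Rightarrow> bool" where
  "radon_shatters C Y \<longleftrightarrow> (\<forall>Y1 Y2. Y1 \<union> Y2 = Y \<and> Y1 \<inter> Y2 = {} \<longrightarrow>
      cconv C Y1 \<inter> cconv C Y2 = {})"

definition radon_number :: "'a set \<Rightarrow> 'a set set \<Rightarrow> nat" where
  "radon_number X C = (LEAST r. \<not> (\<exists>Y \<subseteq> X. finite Y \<and> card Y = r \<and> radon_shatters C Y))"

definition weak_eps_net :: "'a set \<Rightarrow> 'a set set \<Rightarrow> 'a pmf \<Rightarrow> real \<Rightarrow> 'a set \<Rightarrow> bool" where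
  "weak_eps_net X C \<mu> \<epsilon> S \<longleftrightarrow> S \<subseteq> X \<and>
     (\<forall>c \<in> C. measure_pmf.prob \<mu> c \<ge> \<epsilon> \<longrightarrow> S \<inter> c \<noteq> {})"

end

theory Submission
  imports Defs
begin

text \<open>
  Upper bound: halfspaces shattered in the VC sense are Radon-shattered, so halfspaces have VC
  dimension below \<open>r\<close> and, up to \<open>\<epsilon> / (8 r)\<close>, finitely many halfspaces \<open>b'\<close> approximate all of them.
  By Helly's theorem some point \<open>p\<close> lies in every convex set of measure above \<open>1 - 1/r\<close>. A convex set
  \<open>c\<close> with \<open>\<mu>(c) \<ge> \<epsilon>\<close> that misses \<open>p\<close> lies, by separability, in a halfspace of measure at most
  \<open>1 - 1/r\<close>, hence essentially in one of the \<open>b'\<close>, and conditioning on \<open>b'\<close> raises its measure by a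
  factor \<open>exp (1 / (2 r))\<close>. After about \<open>2 r ln (1/\<epsilon>)\<close> such steps only centre points are needed.

  Lower bound: let \<open>\<mu>\<close> be uniform on a Radon-shattered set \<open>Y\<close> of size \<open>r\<close>. Colouring each quarter of
  \<open>Y\<close> by a net point in its hull is a proper colouring of a Kneser graph, so the
  Lovasz-Kneser bound applies. It is obtained from the combinatorial Ky Fan lemma on signed sets, by a
  parity count over maximal chains, following Matousek.
\<close>

section \<open>Convex hulls and Radon-shattered sets\<close>

lemma subset_cconv: "Y \<subseteq> cconv C Y"
  by (auto simp: cconv_def)

lemma cconv_subset: "c \<in> C \<Longrightarrow> Y \<subseteq> c \<Longrightarrow> cconv C Y \<subseteq> c"
  by (auto simp: cconv_def)

lemma cconv_mono: "Y \<subseteq> Z \<Longrightarrow> cconv C Y \<subseteq> cconv C Z"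
  by (auto simp: cconv_def)

lemma cconv_in:
  assumes "convexity_space X C" and "Y \<subseteq> X"
  shows "cconv C Y \<in> C"
proof -
  have "{c \<in> C. Y \<subseteq> c} \<noteq> {}" using assms by (auto simp: convexity_space_def)
  then show ?thesis using assms by (simp add: convexity_space_def cconv_def)
qed

text \<open>The definition speaks of partitions of all of \<open>Y\<close>; enlarging
  \<open>Y2\<close> to \<open>Y - Y1\<close> only enlarges its hull.\<close>

lemma radon_shatters_disjoint:
  assumes "radon_shatters C Y" and "Y1 \<subseteq> Y" and "Y2 \<subseteq> Y" and "Y1 \<inter> Y2 = {}"
  shows "cconv C Y1 \<inter> cconv C Y2 = {}"
proof -
  have "cconv C Y1 \<inter> cconv C (Y - Y1) = {}"
    using assms(1)[unfolded radon_shatters_def, rule_format, of Y1 "Y - Y1"] assms(2) by auto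
  moreover have "cconv C Y2 \<subseteq> cconv C (Y - Y1)" using assms(3,4) by (intro cconv_mono) auto
  ultimately show ?thesis by blast
qed

lemma radon_shatters_subset: "radon_shatters C Y \<Longrightarrow> Z \<subseteq> Y \<Longrightarrow> radon_shatters C Z"
  unfolding radon_shatters_def[of C Z] by (intro allI impI radon_shatters_disjoint[of C Y]) auto

section \<open>The combinatorial Ky Fan lemma\<close>

fun alternating :: "int \<Rightarrow> int list \<Rightarrow> bool" where
  "alternating s [] = True"
| "alternating s (x # xs) = (sgn x = s \<and> (\<forall>y\<in>set xs. \<bar>x\<bar> < \<bar>y\<bar>) \<and> alternating (- s) xs)"

text \<open>The parity counts see only the collection of labels of a simplex, not an order. Strictly
  increasing absolute values leave at most one list as witness.\<close>

definition alternating_mset :: "int \<Rightarrow> int multiset \<Rightarrow> bool" where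
  "alternating_mset s M \<longleftrightarrow> (\<exists>xs. mset xs = M \<and> alternating s xs)"

lemma alternating_sorted: "alternating s xs \<Longrightarrow> sorted (map abs xs)"
  by (induction xs arbitrary: s) (auto intro: less_imp_le)

lemma alternating_distinct: "alternating s xs \<Longrightarrow> distinct (map abs xs)"
  by (induction xs arbitrary: s) fastforce+

lemma alternating_uminus: "alternating (- s) (map uminus xs) \<longleftrightarrow> alternating s xs"
proof (induction xs arbitrary: s)
  case (Cons x xs)
  then show ?case using Cons.IH[of "- s"] by (auto simp: sgn_minus)
qed simp

lemma alternating_mset_uminus:
  "alternating_mset (- s) (image_mset uminus M) \<longleftrightarrow> alternating_mset s M"
proof -
  have *: "alternating_mset (- s) (image_mset uminus M)" if "alternating_mset s M" for s M
    using that unfolding alternating_mset_def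
    by (metis alternating_uminus mset_map)
  have "alternating_mset s M" if "alternating_mset (- s) (image_mset uminus M)"
    using *[OF that] by (simp add: multiset.map_comp comp_def)
  with * show ?thesis by blast
qed

text \<open>Without complementary labels \<open>abs\<close> is injective on the labels, so sorting
  by absolute value determines the list.\<close>

lemma alternating_mset_sorted:
  assumes "sorted (map abs xs)" and "\<forall>x\<in>set xs. \<forall>y\<in>set xs. x \<noteq> - y"
  shows "alternating_mset s (mset xs) \<longleftrightarrow> alternating s xs"
proof
  assume "alternating_mset s (mset xs)"
  then obtain ys where ys: "mset ys = mset xs" "alternating s ys"
    by (auto simp: alternating_mset_def)
  have "map abs ys = map abs xs"
    using alternating_sorted[OF ys(2)] ys(1) assms(1)
    by (metis mset_map properties_for_sort sorted_sort_id)
  moreover have "inj_on abs (set ys \<union> set xs)"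
    using assms(2) mset_eq_setD[OF ys(1)] by (auto simp: inj_on_def abs_eq_iff)
  ultimately have "ys = xs" by (rule map_inj_on)
  then show "alternating s xs" using ys by simp
qed (auto simp: alternating_mset_def)

text \<open>Ky Fan's parity argument at one simplex, by splitting off a label \<open>x\<close> of
  least absolute value. Dropping \<open>x\<close> leaves the tail; dropping another label keeps
  \<open>x\<close> in front and asks for the opposite sign afterwards, hence the induction
  hypothesis at \<open>- s\<close>.\<close>

lemma even_alternating_facets_list:
  assumes "sorted (map abs xs)" and "\<forall>x\<in>set xs. \<forall>y\<in>set xs. x \<noteq> - y" and "s = 1 \<or> s = -1"
  shows "even ((\<Sum>i<length xs. of_bool (alternating s (take i xs @ drop (Suc i) xs)))
           + of_bool (alternating s xs) + of_bool (alternating (- s) xs) :: nat)"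
  using assms
proof (induction xs arbitrary: s)
  case Nil
  then show ?case by simp
next
  case (Cons x ys)
  let ?D = "\<lambda>s xs. (\<Sum>i<length xs. of_bool (alternating s (take i xs @ drop (Suc i) xs))) :: nat"
  have "x \<noteq> - x" using Cons.prems(2) by (meson list.set_intros(1))
  then have sgn: "sgn x = s \<or> sgn x = - s" using Cons.prems(3) by (auto simp: sgn_if)
  have D: "?D s (x # ys) = of_bool (alternating s ys) +
     (\<Sum>i<length ys. of_bool (alternating s (x # take i ys @ drop (Suc i) ys)))"
    by (simp add: sum.lessThan_Suc_shift del: alternating.simps sum.lessThan_Suc)
  have sorted: "\<forall>y\<in>set ys. \<bar>x\<bar> \<le> \<bar>y\<bar>" using Cons.prems(1) by simp
  show ?case
  proof (cases "ys = [] \<or> \<bar>x\<bar> < \<bar>hd ys\<bar>")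
    case True
    then have less: "\<forall>y\<in>set ys. \<bar>x\<bar> < \<bar>y\<bar>"
      using Cons.prems(1) by (cases ys) auto
    then have "(\<forall>y\<in>set (take i ys @ drop (Suc i) ys). \<bar>x\<bar> < \<bar>y\<bar>)" for i
      by (auto dest: in_set_takeD in_set_dropD)
    then have "(\<Sum>i<length ys. of_bool (alternating s (x # take i ys @ drop (Suc i) ys)))
       = (if sgn x = s then ?D (- s) ys else 0)"
      by simp
    moreover have "even (?D (- s) ys + of_bool (alternating (- s) ys) + of_bool (alternating s ys))"
      using Cons.IH[of "- s"] Cons.prems by auto
    ultimately show ?thesis
      using D sgn less Cons.prems(3) by (auto simp: of_bool_def split: if_splits)
  next
    case False
    \<comment> \<open>The two smallest labels coincide: only dropping one of them can leave an alternating list,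
      and both choices leave the same list.\<close>
    then obtain y zs where ys: "ys = y # zs" by (cases ys) auto
    have "\<bar>x\<bar> = \<bar>y\<bar>" using False sorted ys by auto
    moreover have "x \<noteq> - y" using Cons.prems(2) ys by auto
    ultimately have y: "y = x" by (auto simp: abs_eq_iff)
    have "(\<Sum>i<length ys. of_bool (alternating s (x # take i ys @ drop (Suc i) ys)))
       = (of_bool (alternating s (x # zs)) :: nat)"
      unfolding ys y by (simp add: sum.lessThan_Suc_shift del: sum.lessThan_Suc)
    then show ?thesis using D ys y by simp
  qed
qed

text \<open>Facets are counted by index, so that equal labels count with multiplicity; sorting the
  labels reduces the count to the list version.\<close>

lemma even_alternating_facets:
  fixes L :: "'i \<Rightarrow> int"
  assumes "finite I" and "\<forall>i\<in>I. \<forall>j\<in>I. L i \<noteq> - L j" and "s = 1 \<or> s = -1"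
  defines "M \<equiv> image_mset L (mset_set I)"
  shows "even (card {i\<in>I. alternating_mset s (image_mset L (mset_set (I - {i})))}
           + of_bool (alternating_mset s M) + of_bool (alternating_mset (- s) M))"
proof -
  obtain xs where xs: "mset xs = M" "sorted (map abs xs)"
    by (metis ex_mset mset_sort sorted_sort_key)
  have "set xs = L ` I" using xs(1) assms(1) unfolding M_def
    by (metis finite_set_mset_mset_set set_image_mset set_mset_mset)
  then have nc: "\<forall>x\<in>set xs. \<forall>y\<in>set xs. x \<noteq> - y" using assms(2) by auto
  define g where "g x = (of_bool (alternating_mset s (M - {#x#})) :: nat)" for x
  have "card {i\<in>I. alternating_mset s (image_mset L (mset_set (I - {i})))} = (\<Sum>i\<in>I. g (L i))"
  proof -
    have "image_mset L (mset_set (I - {i})) = M - {#L i#}" if "i \<in> I" for i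
      using that assms(1) by (simp add: M_def mset_set_Diff image_mset_Diff)
    then show ?thesis using assms(1)
      by (simp add: g_def Collect_conj_eq of_bool_def sum.If_cases cong: sum.cong)
         (intro arg_cong[where f = card], auto)
  qed
  also have "\<dots> = sum_mset (image_mset g M)"
    by (simp add: sum_unfold_sum_mset M_def multiset.map_comp comp_def)
  also have "\<dots> = (\<Sum>i<length xs. g (xs ! i))"
    unfolding xs(1)[symmetric] mset_map[symmetric] sum_mset_sum_list
    by (simp add: sum_list_sum_nth atLeast0LessThan)
  also have "\<dots> = (\<Sum>i<length xs. of_bool (alternating s (take i xs @ drop (Suc i) xs)))"
  proof (rule sum.cong[OF refl])
    fix i assume "i \<in> {..<length xs}"
    then have i: "i < length xs" by simp
    let ?ys = "take i xs @ drop (Suc i) xs"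
    have "mset xs = add_mset (xs ! i) (mset ?ys)"
      by (metis add_mset_add_single i id_take_nth_drop mset.simps(2) mset_append union_mset_add_mset_right)
    then have "M - {#xs ! i#} = mset ?ys" using xs(1) by simp
    moreover have "sorted (map abs ?ys)"
    proof -
      have "sorted (map abs (take i xs @ xs ! i # drop (Suc i) xs))"
        using xs(2) i by (metis id_take_nth_drop)
      then show ?thesis by (simp add: sorted_append)
    qed
    moreover have "set ?ys \<subseteq> set xs" by (auto dest: in_set_takeD in_set_dropD)
    ultimately show "g (xs ! i) = of_bool (alternating s ?ys)"
      using nc unfolding g_def by (subst alternating_mset_sorted[symmetric]) auto
  qed
  finally show ?thesis
    using even_alternating_facets_list[OF xs(2) nc assms(3)] alternating_mset_sorted[OF xs(2) nc] xs(1)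
    by simp
qed

section \<open>Chains of signed sets and the global parity count\<close>

lemma even_card_involution:
  assumes "finite A" and "\<And>x. x \<in> A \<Longrightarrow> f x \<in> A \<and> f x \<noteq> x \<and> f (f x) = x"
  shows "even (card A)"
  using assms
proof (induction A rule: finite_psubset_induct)
  case (psubset A)
  show ?case
  proof (cases "A = {}")
    case False
    then obtain x where x: "x \<in> A" by auto
    have "even (card (A - {x, f x}))"
    proof (rule psubset.IH)
      show "A - {x, f x} \<subset> A" using x by auto
      fix y assume "y \<in> A - {x, f x}"
      then show "f y \<in> A - {x, f x} \<and> f y \<noteq> y \<and> f (f y) = y"
        using psubset.prems[of y] psubset.prems[OF x] by auto
    qed
    moreover have "card A = card (A - {x, f x}) + 2"
    proof -
      have "card {x, f x} = 2" using psubset.prems[OF x] by (auto simp: card_insert_if)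
      then show ?thesis
        using x psubset.prems[OF x] psubset.hyps card_mono[of A "{x, f x}"] by (simp add: card_Diff_subset)
    qed
    ultimately show ?thesis by simp
  qed simp
qed

text \<open>Sign vectors of length \<open>n\<close> with entries \<open>+\<close>, \<open>-\<close>
  and zero, absent coordinates being zero. The second clause also excludes \<open>0\<close>, which
  is its own negative.\<close>

definition signed_set :: "nat \<Rightarrow> int set \<Rightarrow> bool" where
  "signed_set n A \<longleftrightarrow> A \<subseteq> {- int n..int n} \<and> (\<forall>a\<in>A. - a \<notin> A)"

text \<open>The integers \<open>i\<close> and \<open>- i\<close> stand for the two signs of coordinate \<open>i\<close>. A signed permutation
  \<open>xs\<close> encodes the maximal chain of signed sets formed by the prefixes of \<open>xs\<close>, that is, a facet of
  the barycentric subdivision of the cross-polytope boundary.\<close>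
definition signed_perms :: "nat \<Rightarrow> int list set" where
  "signed_perms n = {xs. distinct (map abs xs) \<and> abs ` set xs = {1..int n}}"

text \<open>\<open>I\<close> selects levels of the chain, so that a facet is obtained by omitting
  one; \<open>Suc j\<close> skips the empty prefix, which is not a vertex.\<close>

definition chain_labels :: "(int set \<Rightarrow> int) \<Rightarrow> int list \<Rightarrow> nat set \<Rightarrow> int multiset" where
  "chain_labels l xs I = image_mset (\<lambda>j. l (set (take (Suc j) xs))) (mset_set I)"

lemma signed_set_mono: "signed_set m A \<Longrightarrow> m \<le> n \<Longrightarrow> signed_set n A"
  unfolding signed_set_def by fastforce

lemma length_signed_perms: "xs \<in> signed_perms n \<Longrightarrow> length xs = n"
proof -
  assume "xs \<in> signed_perms n"
  then have "distinct (map abs xs)" "set (map abs xs) = {1..int n}" by (auto simp: signed_perms_def)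
  then show ?thesis using distinct_card by fastforce
qed

lemma signed_perms_bound: "xs \<in> signed_perms n \<Longrightarrow> x \<in> set xs \<Longrightarrow> 1 \<le> \<bar>x\<bar> \<and> \<bar>x\<bar> \<le> int n"
  by (force simp: signed_perms_def)

lemma finite_signed_perms: "finite (signed_perms n)"
proof (rule finite_subset)
  show "signed_perms n \<subseteq> {xs. set xs \<subseteq> {- int n..int n} \<and> length xs = n}"
    using signed_perms_bound length_signed_perms by fastforce
qed (simp add: finite_lists_length_eq)

lemma signed_perms_inj: "xs \<in> signed_perms n \<Longrightarrow> x \<in> set xs \<Longrightarrow> y \<in> set xs \<Longrightarrow> \<bar>x\<bar> = \<bar>y\<bar> \<Longrightarrow> x = y"
  by (auto simp: signed_perms_def distinct_map inj_on_def)

lemma signed_set_take: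
  assumes "xs \<in> signed_perms n"
  shows "signed_set n (set (take k xs))"
proof -
  have "set (take k xs) \<subseteq> set xs" by (rule set_take_subset)
  moreover have "- a \<notin> set xs" if "a \<in> set xs" for a
    using signed_perms_inj[OF assms that, of "- a"] signed_perms_bound[OF assms that] by auto
  ultimately show ?thesis using signed_perms_bound[OF assms] unfolding signed_set_def by fastforce
qed

text \<open>Ky Fan's theorem for antipodal labellings, by induction on the dimension: the
  alternating simplices of a hemisphere, of either starting sign, have together the parity of the
  alternating simplices of the equator. Antipodality moves those of negative starting sign to the
  other hemisphere with positive sign.\<close>

lemma odd_card_signed_perms:
  assumes "\<And>A. signed_set n A \<Longrightarrow> A \<noteq> {} \<Longrightarrow> l (uminus ` A) = - l A"
    and "\<And>A B. signed_set n B \<Longrightarrow> A \<subseteq> B \<Longrightarrow> A \<noteq> {} \<Longrightarrow> l A \<noteq> - l B"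
  shows "odd (card {xs \<in> signed_perms n. alternating_mset 1 (chain_labels l xs {..<n})})"
  using assms
proof (induction n)
  case 0
  have "{xs \<in> signed_perms 0. alternating_mset 1 (chain_labels l xs {..<0})} = {[]}"
    by (auto simp: signed_perms_def chain_labels_def alternating_mset_def)
  then show ?case by simp
next
  case (Suc n)
  \<comment> \<open>The pairs in \<open>P\<close> of a chain in the hemisphere \<open>H\<close> and an omitted level are counted modulo 2 in
    two ways: chain by chain, and by exchanging a chain for the other one that agrees with it away
    from the omitted level. Only pairs in \<open>Q\<close>, whose facet lies on the equator, have no partner.\<close>
  define H where "H = {xs \<in> signed_perms (Suc n). int (Suc n) \<in> set xs}"
  define facet where "facet xs i = alternating_mset 1 (chain_labels l xs ({..<Suc n} - {i}))" for xs i
  define full where "full s xs = alternating_mset s (chain_labels l xs {..<Suc n})" for s xs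
  define P where "P = {(xs, i). xs \<in> H \<and> i < Suc n \<and> facet xs i}"
  define Q where "Q = {(xs, i). (xs, i) \<in> P \<and> i = n \<and> xs ! n = int (Suc n)}"
  have IH: "odd (card {xs \<in> signed_perms n. alternating_mset 1 (chain_labels l xs {..<n})})"
    using Suc.IH Suc.prems signed_set_mono[of n _ "Suc n"] by auto
  have finH: "finite H" by (simp add: H_def finite_signed_perms)
  have finP: "finite P"
    by (rule finite_subset[of _ "H \<times> {..<Suc n}"]) (auto simp: P_def finH)
  have lenH: "length xs = Suc n" if "xs \<in> H" for xs using that length_signed_perms H_def by auto
  have take_ne: "set (take (Suc j) xs) \<noteq> {}" if "xs \<in> signed_perms (Suc n)" for xs j
    using length_signed_perms[OF that] by (cases xs) auto

  have local: "even (card {i\<in>{..<Suc n}. facet xs i} + of_bool (full 1 xs) + of_bool (full (-1) xs))"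
    if xs: "xs \<in> H" for xs
    unfolding facet_def full_def chain_labels_def
  proof (rule even_alternating_facets)
    have xs': "xs \<in> signed_perms (Suc n)" using xs H_def by simp
    have *: "l (set (take (Suc i) xs)) \<noteq> - l (set (take (Suc j) xs)) \<and>
             l (set (take (Suc j) xs)) \<noteq> - l (set (take (Suc i) xs))" if "i \<le> j" for i j
    proof -
      have "set (take (Suc i) xs) \<subseteq> set (take (Suc j) xs)"
        using that by (simp add: set_take_subset_set_take)
      then have "l (set (take (Suc i) xs)) \<noteq> - l (set (take (Suc j) xs))"
        by (rule Suc.prems(2)[OF signed_set_take[OF xs']]) (rule take_ne[OF xs'])
      then show ?thesis by auto
    qed
    show "\<forall>i\<in>{..<Suc n}. \<forall>j\<in>{..<Suc n}. l (set (take (Suc i) xs)) \<noteq> - l (set (take (Suc j) xs))"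
      using * by (meson nle_le)
  qed auto

  have "card P = (\<Sum>xs\<in>H. card {i\<in>{..<Suc n}. facet xs i})"
  proof -
    have "P = Sigma H (\<lambda>xs. {i\<in>{..<Suc n}. facet xs i})" by (auto simp: P_def)
    then show ?thesis using finH by (simp add: card_SigmaI)
  qed
  moreover have "even (\<Sum>xs\<in>H. card {i\<in>{..<Suc n}. facet xs i} + of_bool (full 1 xs) + of_bool (full (-1) xs))"
    using local by (intro dvd_sum) auto
  moreover have "(\<Sum>xs\<in>H. of_bool (full s xs)) = card {xs\<in>H. full s xs}" for s
    using finH by (simp add: of_bool_def sum.If_cases Collect_conj_eq)
  ultimately have P_parity: "even (card P + card {xs\<in>H. full 1 xs} + card {xs\<in>H. full (-1) xs})"
    by (simp add: sum.distrib)

  have "even (card (P - Q))"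
  proof -
    \<comment> \<open>Swapping the entries \<open>i\<close> and \<open>Suc i\<close> changes only
      the prefix of length \<open>Suc i\<close>; negating the last entry changes only the whole set.
      The latter leaves \<open>H\<close> exactly when the last entry is \<open>Suc n\<close>, the
      case set aside in \<open>Q\<close>.\<close>
    define f where "f = (\<lambda>(xs :: int list, i).
      (if i < n then xs[i := xs ! Suc i, Suc i := xs ! i] else xs[n := - (xs ! n)], i))"
    show ?thesis
    proof (rule even_card_involution[where f = f])
      fix p assume p: "p \<in> P - Q"
      obtain xs i where pi: "p = (xs, i)" by (cases p)
      have xs: "xs \<in> H" "xs \<in> signed_perms (Suc n)" and len: "length xs = Suc n"
        and i: "i < Suc n" and facet: "facet xs i"
        using p pi lenH by (auto simp: P_def H_def)
      have dist: "distinct (map abs xs)" and abs: "abs ` set xs = {1..int (Suc n)}"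
        using xs(2) by (auto simp: signed_perms_def)
      define ys where "ys = fst (f p)"
      have fp: "f p = (ys, i)" by (simp add: ys_def pi f_def)
      have leny: "length ys = Suc n" using len by (simp add: ys_def pi f_def)
      have mset_abs: "mset (map abs ys) = mset (map abs xs)"
      proof (cases "i < n")
        case True
        then have "mset ys = mset xs"
          using len mset_swap[of "Suc i" xs i] by (simp add: ys_def pi f_def)
        then show ?thesis by (metis mset_map)
      next
        case False
        then have "map abs ys = map abs xs"
          by (intro nth_equalityI) (use len in \<open>auto simp: ys_def pi f_def nth_list_update\<close>)
        then show ?thesis by simp
      qed
      have "ys \<in> signed_perms (Suc n)"
        using dist abs mset_eq_imp_distinct_iff[OF mset_abs] mset_eq_setD[OF mset_abs]
        by (simp add: signed_perms_def)
      moreover have "int (Suc n) \<in> set ys"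
      proof (cases "i < n")
        case True
        then have "set ys = set xs" using len by (simp add: ys_def pi f_def)
        then show ?thesis using xs(1) by (simp add: H_def)
      next
        case False
        then have "i = n" using i by simp
        then have "xs ! n \<noteq> int (Suc n)" using p pi by (auto simp: Q_def)
        moreover obtain j where j: "j < Suc n" "xs ! j = int (Suc n)"
          using xs(1) len by (auto simp: H_def in_set_conv_nth)
        ultimately have "j < n" using less_Suc_eq by auto
        then have "ys ! j = int (Suc n)" using j False by (simp add: ys_def pi f_def)
        then show ?thesis using j leny by (metis nth_mem)
      qed
      ultimately have ysH: "ys \<in> H" by (simp add: H_def)
      have take_eq: "set (take (Suc j) ys) = set (take (Suc j) xs)" if "j \<in> {..<Suc n} - {i}" for j
      proof (cases "i < n")
        case True
        show ?thesis
        proof (cases "j < i")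
          case True
          then show ?thesis using \<open>i < n\<close> by (simp add: ys_def pi f_def)
        next
          case False
          then have *: "take (Suc j) ys = (take (Suc j) xs)[i := take (Suc j) xs ! Suc i, Suc i := take (Suc j) xs ! i]"
            using that \<open>i < n\<close> by (simp add: ys_def pi f_def take_update_swap)
          have "length (take (Suc j) xs) = Suc j" "i < Suc j" "Suc i < Suc j"
            using that False len by auto
          then show ?thesis unfolding * by (intro set_swap) simp_all
        qed
      next
        case False
        then show ?thesis using that i by (simp add: ys_def pi f_def)
      qed
      have "chain_labels l ys ({..<Suc n} - {i}) = chain_labels l xs ({..<Suc n} - {i})"
        unfolding chain_labels_def by (intro image_mset_cong) (use take_eq in auto)
      then have "facet ys i" using facet by (simp add: facet_def)
      then have "f p \<in> P" using fp ysH i by (simp add: P_def)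
      moreover have "f p \<notin> Q"
      proof (cases "i < n")
        case False
        then have "i = n" using i by simp
        have "xs ! n \<noteq> - int (Suc n)"
        proof
          assume *: "xs ! n = - int (Suc n)"
          have "xs ! n \<in> set xs" using len by simp
          then have "xs ! n = int (Suc n)"
            using signed_perms_inj[OF xs(2), of "xs ! n" "int (Suc n)"] xs(1) * by (simp add: H_def)
          then show False using * by simp
        qed
        then have "ys ! n \<noteq> int (Suc n)" using \<open>i = n\<close> len by (simp add: ys_def pi f_def)
        then show ?thesis using fp by (simp add: Q_def)
      qed (simp add: fp Q_def)
      moreover have "f p \<noteq> p"
      proof (cases "i < n")
        case True
        have "xs ! i \<noteq> xs ! Suc i" using dist True len by (simp add: distinct_map nth_eq_iff_index_eq)
        then have "ys ! i \<noteq> xs ! i" using True len by (simp add: ys_def pi f_def)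
        then show ?thesis using fp pi by auto
      next
        case False
        have "xs ! n \<in> set xs" using len by simp
        then have "xs ! n \<noteq> 0" using signed_perms_bound[OF xs(2)] by force
        then have "ys ! n \<noteq> xs ! n" using False len by (simp add: ys_def pi f_def)
        then show ?thesis using fp pi by auto
      qed
      moreover have "f (f p) = p"
      proof (cases "i < n")
        case True
        then show ?thesis using len by (auto simp: f_def pi intro!: nth_equalityI simp: nth_list_update)
      next
        case False
        then show ?thesis using len by (auto simp: f_def pi)
      qed
      ultimately show "f p \<in> P - Q \<and> f p \<noteq> p \<and> f (f p) = p" by blast
    qed (simp add: finP)
  qed
  moreover have "Q \<subseteq> P" by (auto simp: Q_def)
  ultimately have PQ: "even (card P + card Q)"
    using finP card_mono[OF finP, of Q] card_Diff_subset[of Q P] finite_subset[of Q P] by auto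

  \<comment> \<open>The omitted level is the last one, so the labels are those of the shorter chain,
    and \<open>Suc n\<close> is the only entry that can complete that chain inside
    \<open>H\<close>.\<close>
  have "bij_betw (\<lambda>xs. (xs @ [int (Suc n)], n))
     {xs \<in> signed_perms n. alternating_mset 1 (chain_labels l xs {..<n})} Q"
  proof (rule bij_betwI[where g = "\<lambda>(xs, i). butlast xs"])
    have labels: "chain_labels l (xs @ [int (Suc n)]) ({..<Suc n} - {n}) = chain_labels l xs {..<n}"
      if "length xs = n" for xs
    proof -
      have *: "{..<Suc n} - {n} = {..<n}" by auto
      show ?thesis unfolding chain_labels_def * by (intro image_mset_cong) (simp add: that)
    qed
    have interval: "{1..int (Suc n)} = insert (int (Suc n)) {1..int n}" by auto
    show "(\<lambda>xs. (xs @ [int (Suc n)], n)) \<in>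
      {xs \<in> signed_perms n. alternating_mset 1 (chain_labels l xs {..<n})} \<rightarrow> Q"
    proof
      fix xs assume xs: "xs \<in> {xs \<in> signed_perms n. alternating_mset 1 (chain_labels l xs {..<n})}"
      then have len: "length xs = n" using length_signed_perms by auto
      have "xs @ [int (Suc n)] \<in> H"
      proof -
        have d: "distinct (map abs xs)" "abs ` set xs = {1..int n}" using xs by (simp_all add: signed_perms_def)
        then have "int (Suc n) \<notin> abs ` set xs" by simp
        then have "distinct (map abs (xs @ [int (Suc n)]))" using d(1) by simp
        moreover have "abs ` set (xs @ [int (Suc n)]) = {1..int (Suc n)}" unfolding interval using d(2) by simp
        ultimately show ?thesis unfolding H_def signed_perms_def by simp
      qed
      then show "(xs @ [int (Suc n)], n) \<in> Q"
        using xs labels[OF len] len by (simp add: Q_def P_def facet_def nth_append)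
    qed
    show "(\<lambda>(xs, i). butlast xs) \<in> Q \<rightarrow>
      {xs \<in> signed_perms n. alternating_mset 1 (chain_labels l xs {..<n})}"
    proof
      fix p assume p: "p \<in> Q"
      then obtain xs where xs: "p = (xs, n)" "xs \<in> H" "facet xs n" "xs ! n = int (Suc n)"
        by (auto simp: Q_def P_def)
      have len: "length xs = Suc n" using xs lenH by simp
      define ys where "ys = butlast xs"
      have "xs \<noteq> []" using len by auto
      then have ys: "xs = ys @ [int (Suc n)]" "length ys = n"
        using len xs(4) append_butlast_last_id[of xs] last_conv_nth[of xs] by (auto simp: ys_def)
      have d: "distinct (map abs xs)" "abs ` set xs = insert (int (Suc n)) {1..int n}"
        using xs(2) interval by (auto simp: H_def signed_perms_def)
      have "insert (int (Suc n)) (abs ` set ys) = insert (int (Suc n)) {1..int n}"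
        using d(2) unfolding ys(1) by auto
      moreover have "int (Suc n) \<notin> abs ` set ys" using d(1) unfolding ys(1) by auto
      ultimately have "abs ` set ys = {1..int n}"
        using insert_ident[of "int (Suc n)" "abs ` set ys" "{1..int n}"] by simp
      then have "ys \<in> signed_perms n" using d(1) unfolding ys(1) by (simp add: signed_perms_def)
      moreover have "alternating_mset 1 (chain_labels l ys {..<n})"
        using xs(3) labels[OF ys(2)] unfolding ys(1) by (simp add: facet_def)
      ultimately show "(case p of (xs, i) \<Rightarrow> butlast xs) \<in>
         {xs \<in> signed_perms n. alternating_mset 1 (chain_labels l xs {..<n})}"
        using xs(1) ys_def by simp
    qed
    show "(\<lambda>xs. (xs @ [int (Suc n)], n)) (case y of (xs, i) \<Rightarrow> butlast xs) = y" if y: "y \<in> Q" for y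
    proof -
      obtain xs where xs: "y = (xs, n)" "xs \<in> H" "xs ! n = int (Suc n)" using y by (auto simp: Q_def P_def)
      then show ?thesis using lenH[OF xs(2)] append_butlast_last_id[of xs] last_conv_nth[of xs] by (cases "xs = []") auto
    qed
  qed simp
  then have "card Q = card {xs \<in> signed_perms n. alternating_mset 1 (chain_labels l xs {..<n})}"
    by (simp add: bij_betw_same_card)
  with IH PQ have "odd (card P)" by simp
  with P_parity have odd: "odd (card {xs\<in>H. full 1 xs} + card {xs\<in>H. full (-1) xs})"
    unfolding even_add by blast

  \<comment> \<open>Negation exchanges the hemisphere \<open>H\<close> with the opposite one
    \<open>?H'\<close> and flips the starting sign.\<close>
  let ?H' = "{xs \<in> signed_perms (Suc n). int (Suc n) \<notin> set xs}"
  have neg: "map uminus xs \<in> signed_perms (Suc n) \<and> (int (Suc n) \<in> set (map uminus xs) \<longleftrightarrow> int (Suc n) \<notin> set xs)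
     \<and> (full (- s) (map uminus xs) \<longleftrightarrow> full s xs)"
    if xs: "xs \<in> signed_perms (Suc n)" for xs s
  proof (intro conjI)
    show "map uminus xs \<in> signed_perms (Suc n)"
      using xs by (simp add: signed_perms_def comp_def image_image)
    have "int (Suc n) \<in> abs ` set xs" using xs by (auto simp: signed_perms_def)
    then obtain x where x: "x \<in> set xs" "int (Suc n) = \<bar>x\<bar>" by blast
    then have "x = int (Suc n) \<or> x = - int (Suc n)" by linarith
    with x(1) have "int (Suc n) \<in> set xs \<or> - int (Suc n) \<in> set xs" by metis
    moreover have "\<not> (int (Suc n) \<in> set xs \<and> - int (Suc n) \<in> set xs)"
      using signed_perms_inj[OF xs, of "int (Suc n)" "- int (Suc n)"] by fastforce
    moreover have "int (Suc n) \<in> set (map uminus xs) \<longleftrightarrow> - int (Suc n) \<in> set xs"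
      by (metis (no_types, lifting) image_iff list.set_map minus_minus)
    ultimately show "int (Suc n) \<in> set (map uminus xs) \<longleftrightarrow> int (Suc n) \<notin> set xs" by blast
    have "chain_labels l (map uminus xs) {..<Suc n} = image_mset uminus (chain_labels l xs {..<Suc n})"
      unfolding chain_labels_def multiset.map_comp
      using Suc.prems(1)[OF signed_set_take[OF xs] take_ne[OF xs]]
      by (intro image_mset_cong) (simp add: take_map del: take_Suc_Cons)
    then show "full (- s) (map uminus xs) \<longleftrightarrow> full s xs"
      by (simp add: full_def alternating_mset_uminus)
  qed
  have "bij_betw (map uminus) {xs\<in>H. full (-1) xs} {xs\<in>?H'. full 1 xs}"
    by (rule bij_betwI[where g = "map uminus"]) (use neg[of _ 1] neg[of _ "-1"] in \<open>auto simp: H_def comp_def\<close>)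
  then have "card {xs\<in>H. full (-1) xs} = card {xs\<in>?H'. full 1 xs}" by (rule bij_betw_same_card)
  moreover have "card {xs\<in>signed_perms (Suc n). full 1 xs} = card {xs\<in>H. full 1 xs} + card {xs\<in>?H'. full 1 xs}"
    by (subst card_Un_disjoint[symmetric])
      (auto simp: H_def finite_signed_perms intro!: arg_cong[where f = card])
  ultimately show ?case using odd by (simp add: full_def)
qed

text \<open>An odd count is not zero, so some maximal chain has alternating labels, and these
  \<open>n\<close> labels have distinct absolute values. The label 0 is excluded by the second
  hypothesis with \<open>A = B\<close>.\<close>

lemma antipodal_labelling_bound:
  assumes "\<And>A. signed_set n A \<Longrightarrow> A \<noteq> {} \<Longrightarrow> l (uminus ` A) = - l A"
    and "\<And>A B. signed_set n B \<Longrightarrow> A \<subseteq> B \<Longrightarrow> A \<noteq> {} \<Longrightarrow> l A \<noteq> - l B"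
    and "\<And>A. signed_set n A \<Longrightarrow> A \<noteq> {} \<Longrightarrow> \<bar>l A\<bar> \<le> int m"
  shows "n \<le> m"
proof -
  have "odd (card {xs \<in> signed_perms n. alternating_mset 1 (chain_labels l xs {..<n})})"
    using odd_card_signed_perms[of n l] assms(1,2) by blast
  then have "{xs \<in> signed_perms n. alternating_mset 1 (chain_labels l xs {..<n})} \<noteq> {}" by force
  then obtain xs where xs: "xs \<in> signed_perms n" "alternating_mset 1 (chain_labels l xs {..<n})" by auto
  then obtain zs where zs: "mset zs = chain_labels l xs {..<n}" "alternating 1 zs"
    by (auto simp: alternating_mset_def)
  have "length zs = n"
    by (metis zs(1) chain_labels_def size_image_mset size_mset size_mset_set card_lessThan)
  moreover have "set (map abs zs) \<subseteq> {1..int m}"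
  proof -
    have "1 \<le> \<bar>z\<bar> \<and> \<bar>z\<bar> \<le> int m" if "z \<in> set zs" for z
    proof -
      have "z \<in># chain_labels l xs {..<n}" using that zs(1) by (metis set_mset_mset)
      then obtain j where j: "j < n" "z = l (set (take (Suc j) xs))" by (auto simp: chain_labels_def)
      then have "set (take (Suc j) xs) \<noteq> {}" using length_signed_perms[OF xs(1)] by auto
      then show ?thesis
        using assms(2)[OF signed_set_take[OF xs(1)] subset_refl, of "Suc j"]
          assms(3)[OF signed_set_take[OF xs(1)], of "Suc j"] j by force
    qed
    then show ?thesis by auto
  qed
  then have "card (set (map abs zs)) \<le> m" using card_mono[of "{1..int m}"] by fastforce
  ultimately show ?thesis using distinct_card[OF alternating_distinct[OF zs(2)]] by simp
qed

section \<open>Kneser colourings from net points\<close>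

text \<open>The Lovasz-Kneser bound in disguise: a point of \<open>S\<close> in the hull colours
  each \<open>k\<close>-subset of \<open>Y\<close>, and Radon-shattering keeps disjoint subsets from
  sharing a colour.\<close>

lemma radon_hitting_set_bound:
  fixes S :: "'a set"
  assumes shat: "radon_shatters C Y" and "finite Y" and "finite S" and "k \<ge> 1"
    and hit: "\<And>Z. Z \<subseteq> Y \<Longrightarrow> card Z \<ge> k \<Longrightarrow> S \<inter> cconv C Z \<noteq> {}"
  shows "card Y \<le> 2 * k - 2 + card S"
proof -
  define n where "n = card Y"
  have "card {1..int n} = card Y" by (simp add: n_def)
  then obtain e where e: "bij_betw e {1..int n} Y"
    using \<open>finite Y\<close> finite_same_card_bij[of "{1..int n}" Y] by auto
  obtain idx where idx: "bij_betw idx S {1..int (card S)}"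
    using \<open>finite S\<close> finite_same_card_bij[of S "{1..int (card S)}"] by auto
  define pos where "pos A = e ` {a\<in>A. a > 0}" for A
  define neg where "neg A = e ` uminus ` {a\<in>A. a < 0}" for A
  have posneg: "pos (uminus ` A) = neg A" "neg (uminus ` A) = pos A" for A
  proof -
    have 1: "{a \<in> uminus ` A. a > 0} = uminus ` {a\<in>A. a < 0}" for A :: "int set" by auto
    have 2: "uminus ` {a \<in> uminus ` A. a < 0} = {a\<in>A. a > 0}" for A :: "int set"
      by force
    show "pos (uminus ` A) = neg A" "neg (uminus ` A) = pos A"
      unfolding pos_def neg_def 1 2 by simp_all
  qed
  have mono: "pos A \<subseteq> pos B" "neg A \<subseteq> neg B" if "A \<subseteq> B" for A B
    using that by (auto simp: pos_def neg_def)
  have sub: "pos A \<subseteq> Y" "neg A \<subseteq> Y" if "signed_set n A" for A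
    using that e unfolding pos_def neg_def signed_set_def bij_betw_def by fastforce+
  have disj: "cconv C (pos A) \<inter> cconv C (neg A) = {}" if A: "signed_set n A" for A
  proof (rule radon_shatters_disjoint[OF shat sub[OF A]])
    have "{a\<in>A. a > 0} \<inter> uminus ` {a\<in>A. a < 0} = {}" using A by (auto simp: signed_set_def)
    moreover have "{a\<in>A. a > 0} \<subseteq> {1..int n}" "uminus ` {a\<in>A. a < 0} \<subseteq> {1..int n}"
      using A by (auto simp: signed_set_def)
    ultimately show "pos A \<inter> neg A = {}"
      using e unfolding pos_def neg_def bij_betw_def by (metis image_empty inj_on_image_Int)
  qed
  have fin: "finite A" if "signed_set n A" for A
    using that finite_subset unfolding signed_set_def by blast
  have card_sum: "card (pos A) + card (neg A) = card A" if A: "signed_set n A" for A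
  proof -
    have inj: "inj_on e {1..int n}" using e by (simp add: bij_betw_def)
    have "{a\<in>A. a > 0} \<subseteq> {1..int n}" "uminus ` {a\<in>A. a < 0} \<subseteq> {1..int n}"
      using A by (auto simp: signed_set_def)
    then have "card (pos A) = card {a\<in>A. a > 0}" "card (neg A) = card {a\<in>A. a < 0}"
      unfolding pos_def neg_def using inj
      by (auto simp: card_image inj_on_subset[of e])
    moreover have "0 \<notin> A" using A unfolding signed_set_def by (metis minus_zero)
    then have "a > 0 \<or> a < 0" if "a \<in> A" for a using that by (cases a "0 :: int" rule: linorder_cases) auto
    then have "A = {a\<in>A. a > 0} \<union> {a\<in>A. a < 0}" by blast
    ultimately show ?thesis
      using fin[OF A] card_Un_disjoint[of "{a\<in>A. a > 0}" "{a\<in>A. a < 0}"] by fastforce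
  qed
  \<comment> \<open>Matousek's labelling: signed sets too small to contain \<open>k\<close> elements of one sign are labelled by
    their size, the others by the first point of \<open>S\<close> in the hull of one of their two sign classes.\<close>
  define small where "small A \<longleftrightarrow> card A \<le> 2 * k - 2" for A :: "int set"
  define colours where "colours A = idx ` (S \<inter> (cconv C (pos A) \<union> cconv C (neg A)))" for A
  define colour where "colour A = Min (colours A)" for A
  define l where "l A = (if small A then (if Min (abs ` A) \<in> A then int (card A) else - int (card A))
     else if colour A \<in> idx ` (S \<inter> cconv C (pos A)) then int (2 * k - 2) + colour A
     else - int (2 * k - 2) - colour A)" for A
  have colour: "colour A \<in> colours A" if A: "signed_set n A" "\<not> small A" for A
  proof -
    \<comment> \<open>Two sign classes with at most \<open>k - 1\<close> elements each would give
      \<open>card A \<le> 2 * k - 2\<close>.\<close>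
    have "card (pos A) \<ge> k \<or> card (neg A) \<ge> k"
      using card_sum[OF A(1)] A(2) by (auto simp: small_def)
    then have "colours A \<noteq> {}"
      using hit[OF sub(1)[OF A(1)]] hit[OF sub(2)[OF A(1)]] by (auto simp: colours_def)
    then show ?thesis unfolding colour_def using \<open>finite S\<close> by (intro Min_in) (auto simp: colours_def)
  qed
  have colour_bounds: "1 \<le> colour A \<and> colour A \<le> int (card S)" if A: "signed_set n A" "\<not> small A" for A
  proof -
    have "colour A \<in> idx ` S" using colour[OF A] by (auto simp: colours_def)
    then show ?thesis using idx by (auto simp: bij_betw_def)
  qed
  have inj: "inj_on idx S" using idx by (simp add: bij_betw_def)
  \<comment> \<open>The two hulls are disjoint and \<open>idx\<close> is injective, so the least
    colour comes from exactly one sign class. This makes the sign of a large label flip under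
    negation.\<close>
  have either: "colour A \<in> idx ` (S \<inter> cconv C (pos A)) \<longleftrightarrow> colour A \<notin> idx ` (S \<inter> cconv C (neg A))"
    if A: "signed_set n A" "\<not> small A" for A
  proof -
    have "idx ` (S \<inter> cconv C (pos A)) \<inter> idx ` (S \<inter> cconv C (neg A)) = {}"
      using inj disj[OF A(1)] by (subst inj_on_image_Int[symmetric, of _ S]) auto
    then show ?thesis using colour[OF A] by (auto simp: colours_def image_Un Int_Un_distrib)
  qed
  have signed_uminus: "signed_set n (uminus ` A)" if "signed_set n A" for A
    using that by (auto simp: signed_set_def)
  have card_uminus: "card (uminus ` A) = card A" for A :: "int set"
    by (simp add: card_image)
  have "n \<le> 2 * k - 2 + card S"
  proof (rule antipodal_labelling_bound[where l = l])
    show anti: "l (uminus ` A) = - l A" if A: "signed_set n A" "A \<noteq> {}" for A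
    proof (cases "small A")
      case True
      \<comment> \<open>A small label takes the sign of the coordinate of least index, which
        negation reverses.\<close>
      have "Min (abs ` A) \<in> abs ` A" using fin[OF A(1)] A(2) by (intro Min_in) auto
      then have "Min (abs ` A) \<in> A \<or> - Min (abs ` A) \<in> A" by (auto simp: abs_if)
      then have "Min (abs ` A) \<in> A \<longleftrightarrow> - Min (abs ` A) \<notin> A"
        using A(1) by (auto simp: signed_set_def)
      moreover have "abs ` uminus ` A = abs ` A" by (simp add: image_image)
      moreover have "x \<in> uminus ` A \<longleftrightarrow> - x \<in> A" for x
        by (metis image_iff minus_minus)
      ultimately show ?thesis using True by (simp add: l_def small_def card_uminus)
    next
      case False
      have "colour (uminus ` A) = colour A"
        by (simp add: colour_def colours_def posneg Un_commute)
      then show ?thesis using False either[OF A(1) False]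
        by (simp add: l_def small_def card_uminus posneg)
    qed
    \<comment> \<open>Small labels have absolute value at most \<open>2 * k - 2\<close> and large
      ones exceed it, so opposite labels are of the same kind.\<close>
    have abs_small: "\<bar>l A\<bar> = int (card A)" if "small A" for A using that by (simp add: l_def)
    have abs_large: "\<bar>l A\<bar> = int (2 * k - 2) + colour A" if "signed_set n A" "\<not> small A" for A
      using that colour_bounds[OF that] by (simp add: l_def)
    show "\<bar>l A\<bar> \<le> int (2 * k - 2 + card S)" if A: "signed_set n A" "A \<noteq> {}" for A
      using abs_small[of A] abs_large[OF A(1)] colour_bounds[OF A(1)]
      by (cases "small A") (auto simp: small_def)
    have nonzero: "l A \<noteq> 0" if A: "signed_set n A" "A \<noteq> {}" for A
    proof -
      have "card A > 0" using A fin[OF A(1)] by (simp add: card_gt_0_iff)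
      then have "\<bar>l A\<bar> > 0"
        using abs_small[of A] abs_large[OF A(1)] colour_bounds[OF A(1)] by (cases "small A") auto
      then show ?thesis by simp
    qed
    show "l A \<noteq> - l B" if B: "signed_set n B" and AB: "A \<subseteq> B" and "A \<noteq> {}" for A B
    proof
      assume eq: "l A = - l B"
      have A: "signed_set n A" using B AB by (auto simp: signed_set_def)
      have abs_eq: "\<bar>l A\<bar> = \<bar>l B\<bar>" using eq by simp
      show False
      proof (cases "small B")
        case True
        then have "small A" using card_mono[OF fin[OF B] AB] by (simp add: small_def)
        then have "card A = card B" using abs_eq abs_small True by simp
        then have "A = B" using card_subset_eq[OF fin[OF B] AB] by simp
        then show False using eq nonzero[OF A \<open>A \<noteq> {}\<close>] by simp
      next
        case False
        have "\<not> small A"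
        proof
          assume "small A"
          then show False using abs_eq abs_small[of A] abs_large[OF B False] colour_bounds[OF B False]
            by (simp add: small_def)
        qed
        then have c: "colour A = colour B" using abs_eq abs_large A B False by simp
        have "colour A > 0" using colour_bounds[OF A \<open>\<not> small A\<close>] by simp
        \<comment> \<open>Opposite signs with the same colour put one point of \<open>S\<close> in
          the hull of the positive class of one set and of the negative class of the other. Since
          \<open>A \<subseteq> B\<close>, both hulls grow into those of \<open>B\<close>, which are
          disjoint.\<close>
        then have "(colour A \<in> idx ` (S \<inter> cconv C (pos A))) \<noteq> (colour B \<in> idx ` (S \<inter> cconv C (pos B)))"
          using eq False \<open>\<not> small A\<close> c by (simp add: l_def split: if_splits)
        moreover have "idx ` (S \<inter> cconv C (pos A)) \<subseteq> idx ` (S \<inter> cconv C (pos B))"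
          and "idx ` (S \<inter> cconv C (neg A)) \<subseteq> idx ` (S \<inter> cconv C (neg B))"
          by (intro image_mono Int_mono cconv_mono mono AB order_refl)+
        ultimately show False
          using either[OF A \<open>\<not> small A\<close>] either[OF B False] c by auto
      qed
    qed
  qed
  then show ?thesis by (simp add: n_def)
qed

lemma weak_quarter_net_bound:
  assumes "finite X" and "convexity_space X C" and "radon_shatters C Y" and "Y \<subseteq> X" and "Y \<noteq> {}"
    and "weak_eps_net X C (pmf_of_set Y) (1/4) S"
  shows "real (card S) \<ge> real (card Y) / 2"
proof -
  \<comment> \<open>A quarter of \<open>card Y\<close>, rounded up: sets of \<open>k\<close>
    elements have measure at least 1/4, and \<open>4 * k \<le> card Y + 3\<close> gives
    \<open>2 * k - 2 < card Y / 2\<close>.\<close>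
  define k where "k = (card Y + 3) div 4"
  have finY: "finite Y" using assms finite_subset by blast
  then have "card Y > 0" using assms by (simp add: card_gt_0_iff)
  then have k: "k \<ge> 1" "card Y \<le> 4 * k" "4 * k \<le> card Y + 3" by (auto simp: k_def)
  have "card Y \<le> 2 * k - 2 + card S"
  proof (rule radon_hitting_set_bound[OF assms(3) finY _ k(1)])
    show "finite S" using assms finite_subset by (auto simp: weak_eps_net_def)
    fix Z assume Z: "Z \<subseteq> Y" "k \<le> card Z"
    have "Z \<subseteq> Y \<inter> cconv C Z" using Z(1) subset_cconv[of Z C] by auto
    then have "card Z \<le> card (Y \<inter> cconv C Z)" using finY by (intro card_mono) auto
    then have "real (card Y) / 4 \<le> card (Y \<inter> cconv C Z)" using Z k by linarith
    then have "measure_pmf.prob (pmf_of_set Y) (cconv C Z) \<ge> 1/4"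
      using finY assms(5) \<open>card Y > 0\<close> by (simp add: measure_pmf_of_set field_simps)
    moreover have "cconv C Z \<in> C" using cconv_in[OF assms(2)] Z assms(4) by blast
    ultimately show "S \<inter> cconv C Z \<noteq> {}" using assms(6) by (simp add: weak_eps_net_def)
  qed
  then show ?thesis using k by linarith
qed

section \<open>Radon and Helly numbers\<close>

text \<open>A shattered set at least as large as the Radon number would contain a shattered subset
  of exactly that size. Finiteness of \<open>X\<close> ensures that the \<open>LEAST\<close> is
  attained, as no subset has \<open>Suc (card X)\<close> elements.\<close>

lemma radon_shatters_card_less:
  assumes "finite X" and "Y \<subseteq> X" and "radon_shatters C Y"
  shows "card Y < radon_number X C"
proof (rule ccontr)
  assume "\<not> card Y < radon_number X C"
  then have "radon_number X C \<le> card Y" by simp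
  then obtain Z where Z: "Z \<subseteq> Y" "card Z = radon_number X C" "finite Z"
    by (rule obtain_subset_with_card_n)
  have "\<not> (\<exists>Y\<subseteq>X. finite Y \<and> card Y = Suc (card X) \<and> radon_shatters C Y)"
    by (auto dest: card_mono[OF assms(1)])
  then have "\<not> (\<exists>Y\<subseteq>X. finite Y \<and> card Y = radon_number X C \<and> radon_shatters C Y)"
    unfolding radon_number_def by (rule LeastI)
  then show False using Z radon_shatters_subset[OF assms(3) Z(1)] assms(2) by blast
qed

lemma ex_radon_shatters:
  "r < radon_number X C \<Longrightarrow> \<exists>Y\<subseteq>X. finite Y \<and> card Y = r \<and> radon_shatters C Y"
  unfolding radon_number_def by (drule not_less_Least) blast

lemma radon_number_pos:
  assumes "finite X" and "convexity_space X C"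
  shows "0 < radon_number X C"
proof -
  have "{} \<in> C" using assms(2) by (simp add: convexity_space_def)
  then have "radon_shatters C {}" by (auto simp: radon_shatters_def cconv_def)
  then show ?thesis using radon_shatters_card_less[OF assms(1), of "{}" C] by simp
qed

text \<open>For each \<open>c\<close> choose \<open>x c\<close> in all members but \<open>c\<close>.
  More than \<open>r\<close> distinct such points have a Radon partition, and each \<open>c\<close>
  contains one of its two parts, hence the common hull point; if two choices coincide, that point
  already lies in every member. Intersecting with \<open>X\<close> handles the empty family.\<close>

lemma helly:
  assumes X: "finite X" and conv: "convexity_space X C" and "radon_number X C \<le> r"
    and "finite F" and "F \<subseteq> C"
    and "\<And>G. G \<subseteq> F \<Longrightarrow> card G \<le> r \<Longrightarrow> X \<inter> \<Inter>G \<noteq> {}"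
  shows "X \<inter> \<Inter>F \<noteq> {}"
  using assms(4-)
proof (induction F rule: finite_psubset_induct)
  case (psubset F)
  show ?case
  proof (cases "card F \<le> r")
    case True
    then show ?thesis using psubset.prems(2)[of F] by simp
  next
    case False
    have "\<exists>x. x \<in> X \<inter> \<Inter>(F - {c})" if "c \<in> F" for c
    proof -
      have "X \<inter> \<Inter>(F - {c}) \<noteq> {}"
      proof (rule psubset.IH)
        show "F - {c} \<subset> F" using that by blast
        show "F - {c} \<subseteq> C" using psubset.prems(1) by blast
        show "X \<inter> \<Inter>G \<noteq> {}" if "G \<subseteq> F - {c}" "card G \<le> r" for G
          using psubset.prems(2)[of G] that by blast
      qed
      then show ?thesis by blast
    qed
    then obtain x where x: "\<And>c. c \<in> F \<Longrightarrow> x c \<in> X \<inter> \<Inter>(F - {c})" by metis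
    show ?thesis
    proof (cases "inj_on x F")
      case True
      have Y: "x ` F \<subseteq> X" using x by auto
      have "\<not> radon_shatters C (x ` F)"
        using radon_shatters_card_less[OF X Y, of C] card_image[OF True] False assms(3) by auto
      then obtain Y1 Y2 p where Y12: "Y1 \<union> Y2 = x ` F" "Y1 \<inter> Y2 = {}"
        and p: "p \<in> cconv C Y1" "p \<in> cconv C Y2"
        by (auto simp: radon_shatters_def)
      have in_c: "x d \<in> c" if "c \<in> F" "d \<in> F" "x d \<noteq> x c" for c d
        using x[OF that(2)] that by auto
      have "p \<in> c" if c: "c \<in> F" for c
      proof -
        have "c \<in> C" using c psubset.prems(1) by auto
        have sub: "Z \<subseteq> c" if Z: "Z \<subseteq> x ` F" "x c \<notin> Z" for Z
        proof
          fix y assume "y \<in> Z"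
          moreover from this obtain d where "d \<in> F" "y = x d" using Z(1) by blast
          ultimately show "y \<in> c" using in_c[OF c, of d] Z(2) by metis
        qed
        have "Y1 \<subseteq> x ` F" "Y2 \<subseteq> x ` F" using Y12(1) by auto
        moreover have "x c \<notin> Y1 \<or> x c \<notin> Y2" using Y12(2) by auto
        ultimately have "Y1 \<subseteq> c \<or> Y2 \<subseteq> c" using sub by metis
        then show ?thesis using cconv_subset[OF \<open>c \<in> C\<close>] p by blast
      qed
      moreover have "p \<in> X"
      proof -
        have "Y1 \<subseteq> X" using Y Y12(1) by blast
        moreover have "X \<in> C" using conv by (simp add: convexity_space_def)
        ultimately show ?thesis using p(1) cconv_subset by blast
      qed
      ultimately show ?thesis by auto
    next
      case False
      then obtain c d where "c \<in> F" "d \<in> F" "c \<noteq> d" "x c = x d" by (auto simp: inj_on_def)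
      then have "x c \<in> X \<inter> \<Inter>F" using x[of c] x[of d] by auto
      then show ?thesis by blast
    qed
  qed
qed

section \<open>Packings of bounded VC dimension\<close>

definition vc_shatters :: "'a set set \<Rightarrow> 'a set \<Rightarrow> bool" where
  "vc_shatters F Z \<longleftrightarrow> (\<forall>W\<subseteq>Z. \<exists>b\<in>F. b \<inter> Z = W)"

text \<open>Pajor's form of the Sauer-Shelah lemma. Split by the element \<open>y\<close>: the
  traces on \<open>Y\<close> form \<open>F0 \<union> F1\<close>, those extending both ways form
  \<open>F0 \<inter> F1\<close>, and a set shattered by the latter remains shattered by
  \<open>F\<close> after adding \<open>y\<close>.\<close>

lemma card_le_card_vc_shatters:
  assumes "finite Y" and "F \<subseteq> Pow Y"
  shows "card F \<le> card {Z. Z \<subseteq> Y \<and> vc_shatters F Z}"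
  using assms
proof (induction Y arbitrary: F rule: finite_induct)
  case empty
  then have "F = {} \<or> F = {{}}" by (simp add: subset_singleton_iff)
  then show ?case
  proof
    assume "F = {{}}"
    then have "{Z. Z \<subseteq> {} \<and> vc_shatters F Z} = {{}}" by (auto simp: vc_shatters_def)
    then show ?thesis using \<open>F = {{}}\<close> by simp
  qed simp
next
  case (insert y Y)
  define F0 where "F0 = {A\<in>F. y \<notin> A}"
  define F1 where "F1 = (\<lambda>A. A - {y}) ` {A\<in>F. y \<in> A}"
  have finF: "finite F" using insert.prems insert.hyps(1) by (auto intro: finite_subset[of F "Pow (insert y Y)"])
  have fin: "finite F0" "finite F1" using finF by (auto simp: F0_def F1_def)
  have "card F1 = card {A\<in>F. y \<in> A}"
    unfolding F1_def by (intro card_image) (auto simp: inj_on_def)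
  moreover have "card F = card F0 + card {A\<in>F. y \<in> A}"
    unfolding F0_def using finF by (subst card_Un_disjoint[symmetric]) (auto intro!: arg_cong[where f = card])
  ultimately have "card F = card (F0 \<union> F1) + card (F0 \<inter> F1)"
    using card_Un_Int[OF fin] by simp
  also have "\<dots> \<le> card {Z. Z \<subseteq> Y \<and> vc_shatters (F0 \<union> F1) Z} + card {Z. Z \<subseteq> Y \<and> vc_shatters (F0 \<inter> F1) Z}"
    using insert.prems by (intro add_mono insert.IH) (auto simp: F0_def F1_def)
  also have "card {Z. Z \<subseteq> Y \<and> vc_shatters (F0 \<inter> F1) Z}
      = card (insert y ` {Z. Z \<subseteq> Y \<and> vc_shatters (F0 \<inter> F1) Z})"
    using insert.hyps(2) by (intro card_image[symmetric]) (auto simp: inj_on_def)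
  also have "card {Z. Z \<subseteq> Y \<and> vc_shatters (F0 \<union> F1) Z} + \<dots>
      = card ({Z. Z \<subseteq> Y \<and> vc_shatters (F0 \<union> F1) Z} \<union> insert y ` {Z. Z \<subseteq> Y \<and> vc_shatters (F0 \<inter> F1) Z})"
    using insert.hyps by (intro card_Un_disjoint[symmetric]) auto
  also have "\<dots> \<le> card {Z. Z \<subseteq> insert y Y \<and> vc_shatters F Z}"
  proof (rule card_mono)
    have "vc_shatters F Z" if Z: "Z \<subseteq> Y" "vc_shatters (F0 \<union> F1) Z" for Z
      unfolding vc_shatters_def
    proof (intro allI impI)
      fix W assume "W \<subseteq> Z"
      then obtain b where b: "b \<in> F0 \<union> F1" "b \<inter> Z = W" using Z(2) by (auto simp: vc_shatters_def)
      then obtain A where "A \<in> F" "b = A \<or> b = A - {y}" by (auto simp: F0_def F1_def)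
      moreover have "y \<notin> Z" using Z(1) insert.hyps(2) by auto
      ultimately show "\<exists>b\<in>F. b \<inter> Z = W" using b(2) by (intro bexI[of _ A]) auto
    qed
    moreover have "vc_shatters F (insert y Z)" if Z: "Z \<subseteq> Y" "vc_shatters (F0 \<inter> F1) Z" for Z
      unfolding vc_shatters_def
    proof (intro allI impI)
      fix W assume W: "W \<subseteq> insert y Z"
      have "y \<notin> Z" using Z(1) insert.hyps(2) by auto
      have "W - {y} \<subseteq> Z" using W by auto
      from Z(2)[unfolded vc_shatters_def, rule_format, OF this]
      obtain b where b: "b \<in> F0" "b \<in> F1" "b \<inter> Z = W - {y}" by blast
      then obtain A where A: "A \<in> F" "y \<in> A" "b = A - {y}" by (auto simp: F1_def)
      show "\<exists>b\<in>F. b \<inter> insert y Z = W"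
      proof (cases "y \<in> W")
        case True
        then show ?thesis using A b(3) by (intro bexI[of _ A]) auto
      next
        case False
        then show ?thesis using b by (intro bexI[of _ b]) (auto simp: F0_def)
      qed
    qed
    ultimately show "{Z. Z \<subseteq> Y \<and> vc_shatters (F0 \<union> F1) Z} \<union> insert y ` {Z. Z \<subseteq> Y \<and> vc_shatters (F0 \<inter> F1) Z}
        \<subseteq> {Z. Z \<subseteq> insert y Y \<and> vc_shatters F Z}"
      by blast
  qed (use insert.hyps in simp)
  finally show ?case .
qed

text \<open>A set of at most \<open>Suc d\<close> elements is a set of at most one element joined to
  one of at most \<open>d\<close>; this crude count replaces the binomial sum.\<close>

lemma card_subsets_card_le:
  assumes "finite Y"
  shows "card {Z. Z \<subseteq> Y \<and> card Z \<le> d} \<le> (1 + card Y) ^ d"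
proof (induction d)
  case 0
  have "{Z. Z \<subseteq> Y \<and> card Z \<le> 0} = {{}}" using assms finite_subset by fastforce
  then show ?case by simp
next
  case (Suc d)
  let ?U = "insert {} ((\<lambda>x. {x}) ` Y)" and ?V = "{Z. Z \<subseteq> Y \<and> card Z \<le> d}"
  have "{Z. Z \<subseteq> Y \<and> card Z \<le> Suc d} \<subseteq> (\<lambda>(U, V). U \<union> V) ` (?U \<times> ?V)"
  proof
    fix Z assume Z: "Z \<in> {Z. Z \<subseteq> Y \<and> card Z \<le> Suc d}"
    then have "finite Z" using assms finite_subset by auto
    show "Z \<in> (\<lambda>(U, V). U \<union> V) ` (?U \<times> ?V)"
    proof (cases "Z = {}")
      case True
      then show ?thesis by (intro image_eqI[of _ _ "({}, {})"]) auto
    next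
      case False
      then obtain z where "z \<in> Z" by auto
      then show ?thesis using Z \<open>finite Z\<close> by (intro image_eqI[of _ _ "({z}, Z - {z})"]) auto
    qed
  qed
  then have "card {Z. Z \<subseteq> Y \<and> card Z \<le> Suc d} \<le> card (?U \<times> ?V)"
    using assms by (intro surj_card_le) auto
  also have "\<dots> \<le> (1 + card Y) * (1 + card Y) ^ d"
  proof -
    have "card ((\<lambda>x. {x}) ` Y) \<le> card Y" by (rule card_image_le[OF assms])
    then have "card ?U \<le> 1 + card Y"
      using card_insert_le_m1[of "1 + card Y" "(\<lambda>x. {x}) ` Y" "{}"] by simp
    then show ?thesis using Suc.IH by (simp add: card_cartesian_product mult_le_mono del: mult_Suc)
  qed
  finally show ?case by simp
qed

lemma sauer_shelah_injective_trace:
  assumes "finite Y" and "inj_on (\<lambda>b. b \<inter> Y) F"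
    and "\<And>Z. Z \<subseteq> Y \<Longrightarrow> vc_shatters F Z \<Longrightarrow> card Z \<le> d"
  shows "card F \<le> (1 + card Y) ^ d"
proof -
  let ?T = "(\<lambda>b. b \<inter> Y) ` F"
  have "card F = card ?T" using assms(2) by (simp add: card_image)
  also have "\<dots> \<le> card {Z. Z \<subseteq> Y \<and> vc_shatters ?T Z}"
    using assms(1) by (intro card_le_card_vc_shatters) auto
  also have "\<dots> \<le> card {Z. Z \<subseteq> Y \<and> card Z \<le> d}"
  proof (rule card_mono)
    have "vc_shatters F Z" if "Z \<subseteq> Y" "vc_shatters ?T Z" for Z
    proof -
      have "b \<inter> Y \<inter> Z = b \<inter> Z" for b using that(1) by auto
      then show ?thesis using that(2) by (simp add: vc_shatters_def)
    qed
    then show "{Z. Z \<subseteq> Y \<and> vc_shatters ?T Z} \<subseteq> {Z. Z \<subseteq> Y \<and> card Z \<le> d}"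
      using assms(3) by auto
  qed (use assms(1) in simp)
  also have "\<dots> \<le> (1 + card Y) ^ d" by (rule card_subsets_card_le[OF assms(1)])
  finally show ?thesis .
qed

text \<open>Greedy form of random sampling: averaging with weights \<open>w\<close>, some point lies
  in at least a fraction \<open>\<delta>\<close> of the sets not yet hit, so each added point
  shrinks their number by the factor \<open>1 - \<delta>\<close>.\<close>

lemma ex_hitting_sample:
  fixes w :: "'a \<Rightarrow> real" and D :: "'i \<Rightarrow> 'a set"
  assumes "finite X" and "finite I" and w: "\<And>x. w x \<ge> 0" and W: "sum w X > 0"
    and D: "\<And>p. p \<in> I \<Longrightarrow> D p \<subseteq> X \<and> sum w (D p) \<ge> \<delta> * sum w X" and "\<delta> \<le> 1"
  shows "\<exists>T\<subseteq>X. card T \<le> m \<and> real (card {p\<in>I. D p \<inter> T = {}}) \<le> (1 - \<delta>) ^ m * card I"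
proof (induction m)
  case 0
  show ?case using \<open>finite I\<close> by (intro exI[of _ "{}"]) simp
next
  case (Suc m)
  then obtain T where T: "T \<subseteq> X" "card T \<le> m" "real (card {p\<in>I. D p \<inter> T = {}}) \<le> (1 - \<delta>) ^ m * card I"
    by auto
  define J where "J = {p\<in>I. D p \<inter> T = {}}"
  have J: "finite J" "J \<subseteq> I" using \<open>finite I\<close> by (auto simp: J_def)
  have "\<exists>x\<in>X. \<delta> * card J \<le> card {p\<in>J. x \<in> D p}"
  proof (rule ccontr)
    assume "\<not> ?thesis"
    then have less: "real (card {p\<in>J. x \<in> D p}) < \<delta> * card J" if "x \<in> X" for x
      using that by force
    obtain x where x: "x \<in> X" "w x > 0"
      using W sum_nonpos[of X w] by (meson not_less)
    have "(\<Sum>x\<in>X. w x * card {p\<in>J. x \<in> D p}) < (\<Sum>x\<in>X. w x * (\<delta> * card J))"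
    proof (rule sum_strict_mono_ex1[OF \<open>finite X\<close>])
      show "\<forall>x\<in>X. w x * card {p\<in>J. x \<in> D p} \<le> w x * (\<delta> * card J)"
        using less w by (intro ballI mult_left_mono) (auto intro: less_imp_le)
      show "\<exists>x\<in>X. w x * card {p\<in>J. x \<in> D p} < w x * (\<delta> * card J)"
        using x less by (intro bexI[of _ x] mult_strict_left_mono) auto
    qed
    also have "\<dots> = (\<Sum>p\<in>J. \<delta> * sum w X)"
      by (simp add: sum_distrib_right[symmetric])
    also have "\<dots> \<le> (\<Sum>p\<in>J. sum w (D p))"
      using D J by (intro sum_mono) auto
    also have "\<dots> = (\<Sum>p\<in>J. \<Sum>x\<in>X. if x \<in> D p then w x else 0)"
    proof (rule sum.cong[OF refl])
      fix p assume "p \<in> J"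
      then have "X \<inter> D p = D p" using D J by blast
      then show "sum w (D p) = (\<Sum>x\<in>X. if x \<in> D p then w x else 0)"
        using sum.inter_restrict[OF \<open>finite X\<close>, of w "D p"] by simp
    qed
    also have "\<dots> = (\<Sum>x\<in>X. \<Sum>p\<in>J. if x \<in> D p then w x else 0)" by (rule sum.swap)
    also have "\<dots> = (\<Sum>x\<in>X. w x * card {p\<in>J. x \<in> D p})"
      using J by (intro sum.cong refl) (simp add: mult.commute flip: sum.inter_filter)
    finally show False by simp
  qed
  then obtain x where x: "x \<in> X" "\<delta> * card J \<le> card {p\<in>J. x \<in> D p}" by auto
  have "{p\<in>I. D p \<inter> insert x T = {}} = J - {p\<in>J. x \<in> D p}" by (auto simp: J_def)
  then have "real (card {p\<in>I. D p \<inter> insert x T = {}}) = real (card J) - card {p\<in>J. x \<in> D p}"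
    using J card_mono[OF J(1), of "{p\<in>J. x \<in> D p}"] by (simp add: card_Diff_subset of_nat_diff)
  also have "\<dots> \<le> (1 - \<delta>) * card J" using x(2) by (simp add: algebra_simps)
  also have "\<dots> \<le> (1 - \<delta>) * ((1 - \<delta>) ^ m * card I)"
    using T(3) \<open>\<delta> \<le> 1\<close> by (intro mult_left_mono) (auto simp: J_def)
  finally have "real (card {p\<in>I. D p \<inter> insert x T = {}}) \<le> (1 - \<delta>) ^ Suc m * card I" by simp
  moreover have "card (insert x T) \<le> Suc m"
    using T(2) card_insert_le_m1[of "Suc m" T x] by simp
  ultimately show ?case using T(1) x(1) by (intro exI[of _ "insert x T"]) auto
qed

text \<open>A weak form of Haussler's packing bound. A sample hitting every symmetric difference
  gives the members of \<open>F\<close> distinct traces, which Sauer-Shelah bounds;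
  \<open>ln (card F)\<close> stays on the right because there are up to \<open>card F ^ 2\<close>
  differences to hit.\<close>

lemma packing_bound:
  fixes w :: "'a \<Rightarrow> real"
  assumes "finite X" and w: "\<And>x. w x \<ge> 0" and W: "sum w X > 0" and "0 < \<delta>"
    and F: "F \<subseteq> Pow X" "F \<noteq> {}"
    and far: "\<And>a b. a \<in> F \<Longrightarrow> b \<in> F \<Longrightarrow> a \<noteq> b \<Longrightarrow> sum w ((a - b) \<union> (b - a)) \<ge> \<delta> * sum w X"
    and vc: "\<And>Z. Z \<subseteq> X \<Longrightarrow> vc_shatters F Z \<Longrightarrow> card Z \<le> d"
  shows "real (card F) \<le> (2 + 2 * ln (card F) / \<delta>) ^ d"
proof -
  define N where "N = card F"
  have finF: "finite F" using F(1) \<open>finite X\<close> finite_subset by blast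
  then have N: "N \<ge> 1" using F(2) by (simp add: N_def Suc_leI card_gt_0_iff)
  \<comment> \<open>Just above \<open>2 * ln N / \<delta>\<close>, so that for
    \<open>\<delta> \<le> 1\<close> the factor \<open>(1 - \<delta>) ^ m\<close> is below
    \<open>1 / N ^ 2\<close> and no pair remains unhit.\<close>
  define m where "m = nat \<lfloor>2 * ln N / \<delta>\<rfloor> + 1"
  have nn: "2 * ln N / \<delta> \<ge> 0" using N \<open>0 < \<delta>\<close> by simp
  have m: "real m \<le> 2 * ln N / \<delta> + 1" "real m > 2 * ln N / \<delta>"
    using nn by (auto simp: m_def) linarith+
  obtain T where T: "T \<subseteq> X" "card T \<le> m" "inj_on (\<lambda>b. b \<inter> T) F"
  proof (cases "\<delta> \<le> 1")
    case True
    define I where "I = {(a, b). a \<in> F \<and> b \<in> F \<and> a \<noteq> b}"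
    define D where "D = (\<lambda>(a, b). (a - b) \<union> (b - a) :: 'a set)"
    have I: "I \<subseteq> F \<times> F" by (auto simp: I_def)
    then have finI: "finite I" using finF finite_subset by blast
    have "card I \<le> N * N" using card_mono[OF _ I] finF by (simp add: card_cartesian_product N_def)
    then have cardI: "real (card I) \<le> real N * real N" by (metis of_nat_le_iff of_nat_mult)
    have "D p \<subseteq> X \<and> sum w (D p) \<ge> \<delta> * sum w X" if "p \<in> I" for p
      using that far F(1) by (force simp: I_def D_def)
    then obtain T where T: "T \<subseteq> X" "card T \<le> m"
        "real (card {p\<in>I. D p \<inter> T = {}}) \<le> (1 - \<delta>) ^ m * card I"
      using ex_hitting_sample[OF \<open>finite X\<close> finI w W _ True, of D m] by blast
    have "(1 - \<delta>) ^ m \<le> exp (- \<delta>) ^ m"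
      using True exp_ge_add_one_self[of "- \<delta>"] by (intro power_mono) auto
    also have "\<dots> = exp (- (m * \<delta>))" by (simp add: exp_of_nat_mult[symmetric])
    also have "\<dots> < exp (- (2 * ln N))" using m(2) \<open>0 < \<delta>\<close> by (simp add: field_simps)
    also have "\<dots> = 1 / (real N * real N)"
      using N by (simp add: exp_minus inverse_eq_divide exp_double power2_eq_square)
    finally have "(1 - \<delta>) ^ m * (real N * real N) < 1" using N by (simp add: field_simps)
    moreover have "(1 - \<delta>) ^ m * card I \<le> (1 - \<delta>) ^ m * (real N * real N)"
      using cardI True by (intro mult_left_mono) auto
    ultimately have "real (card {p\<in>I. D p \<inter> T = {}}) < 1" using T(3) by linarith
    then have "{p\<in>I. D p \<inter> T = {}} = {}" using finI by simp
    then have "inj_on (\<lambda>b. b \<inter> T) F" by (fastforce simp: inj_on_def I_def D_def)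
    then show ?thesis using T that by blast
  next
    \<comment> \<open>Beyond \<open>\<delta> = 1\<close> no two members can be far apart, so
      \<open>F\<close> is a single set and the empty sample suffices.\<close>
    case False
    have "a = b" if "a \<in> F" "b \<in> F" for a b
    proof (rule ccontr)
      assume "a \<noteq> b"
      then have "\<delta> * sum w X \<le> sum w ((a - b) \<union> (b - a))" using far that by blast
      also have "\<dots> \<le> sum w X" using that F(1) w \<open>finite X\<close> by (intro sum_mono2) auto
      finally show False using False W by simp
    qed
    then have "inj_on (\<lambda>b. b \<inter> {}) F" by (auto simp: inj_on_def)
    then show ?thesis using that[of "{}"] by simp
  qed
  have "N \<le> (1 + card T) ^ d" unfolding N_def
    using T \<open>finite X\<close> finite_subset vc by (intro sauer_shelah_injective_trace) blast+
  also have "\<dots> \<le> (1 + m) ^ d" using T(2) by (intro power_mono) auto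
  finally have "real N \<le> (1 + real m) ^ d" by (metis of_nat_1 of_nat_add of_nat_le_iff of_nat_power)
  also have "\<dots> \<le> (2 + 2 * ln N / \<delta>) ^ d" using m(1) by (intro power_mono) auto
  finally show ?thesis by (simp add: N_def)
qed

text \<open>Removes \<open>ln N\<close> from the right: with \<open>y\<close> the
  \<open>r\<close>-th root of \<open>N\<close>, the hypothesis becomes
  \<open>y \<le> 2 + 16 * B * ln y\<close>, and \<open>ln y \<le> 2 * sqrt y\<close> turns this into
  \<open>sqrt y \<le> 34 * B\<close>.\<close>

lemma packing_size_arith:
  fixes N r :: nat and \<epsilon> :: real
  assumes "N \<ge> 1" and "r \<ge> 1" and "0 < \<epsilon>" and "\<epsilon> \<le> 1"
    and le: "real N \<le> (2 + 2 * ln N / (\<epsilon> / (8 * r))) ^ r"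
  shows "real N + 1 \<le> (120 * real r ^ 2 / \<epsilon>) ^ (2 * r)"
proof -
  define B where "B = real r ^ 2 / \<epsilon>"
  define y where "y = root r N"
  define s where "s = sqrt y"
  have yN: "y ^ r = N" using assms by (simp add: y_def)
  have y: "y \<ge> 1" using assms by (simp add: y_def)
  have s: "s \<ge> 1" "s ^ 2 = y" using y by (simp_all add: s_def)
  have B: "B \<ge> 1"
  proof -
    have "real r ^ 2 \<ge> 1" using assms by simp
    then have "\<epsilon> \<le> real r ^ 2" using assms by linarith
    then show ?thesis using assms by (simp add: B_def)
  qed
  have lny: "ln N = r * ln y" using yN y by (metis ln_realpow less_le_trans zero_less_one)
  have "2 + 2 * ln N / (\<epsilon> / (8 * r)) = 2 + 16 * B * ln y"
    by (simp add: lny B_def power2_eq_square field_simps)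
  then have "y ^ r \<le> (2 + 16 * B * ln y) ^ r" using le yN by simp
  moreover have "0 \<le> 2 + 16 * B * ln y" using y B by simp
  ultimately have "y \<le> 2 + 16 * B * ln y"
    using \<open>r \<ge> 1\<close> y by (subst (asm) power_mono_iff) auto
  also have "ln y \<le> 2 * s"
  proof -
    have "ln y = 2 * ln s" using s by (metis ln_realpow less_le_trans of_nat_numeral zero_less_one)
    then show ?thesis using ln_bound[of s] s(1) by simp
  qed
  finally have "s * s \<le> 2 + 16 * B * (2 * s)" using B s(2) by (simp add: power2_eq_square)
  also have "\<dots> \<le> 34 * B * s"
  proof -
    have "1 * 1 \<le> B * s" using B s(1) by (intro mult_mono) auto
    then show ?thesis by simp
  qed
  finally have "s \<le> 34 * B" using s(1) by simp
  then have "s ^ 2 \<le> (34 * B) ^ 2" using s(1) by (intro power_mono) auto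
  then have "y \<le> 1156 * B ^ 2" using s(2) by (simp add: power_mult_distrib)
  \<comment> \<open>The factor 2 pays for the \<open>+ 1\<close> in the conclusion;
    \<open>2 * 1156 = 2312\<close> is far below \<open>14400 = 120 ^ 2\<close>.\<close>
  then have "2 * y \<le> 14400 * B ^ 2" using zero_le_power2[of B] by linarith
  then have "2 * y \<le> (120 * B) ^ 2" by (simp add: power_mult_distrib)
  then have "(2 * y) ^ r \<le> ((120 * B) ^ 2) ^ r" using y by (intro power_mono) auto
  moreover have "real N + 1 \<le> (2 * y) ^ r"
  proof -
    have "(2::real) ^ 1 \<le> 2 ^ r" using \<open>r \<ge> 1\<close> by (intro power_increasing) auto
    then have "2 * real N \<le> 2 ^ r * real N" by (intro mult_right_mono) auto
    then have "real N + 1 \<le> 2 ^ r * real N" using assms(1) by linarith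
    then show ?thesis by (simp add: power_mult_distrib yN)
  qed
  ultimately show ?thesis by (simp add: B_def power_mult)
qed

text \<open>Greedy: an element joins the packing when it is far from all members, and otherwise some
  member covers it.\<close>

lemma ex_maximal_packing:
  assumes "finite B" and sym: "\<And>a b. far a b \<Longrightarrow> far b a" and irr: "\<And>a. \<not> far a a"
  shows "\<exists>P\<subseteq>B. (\<forall>a\<in>P. \<forall>b\<in>P. a \<noteq> b \<longrightarrow> far a b) \<and> (\<forall>b\<in>B. \<exists>p\<in>P. \<not> far b p)"
  using assms(1)
proof (induction B rule: finite_induct)
  case (insert x B)
  then obtain P where P: "P \<subseteq> B" "\<forall>a\<in>P. \<forall>b\<in>P. a \<noteq> b \<longrightarrow> far a b" "\<forall>b\<in>B. \<exists>p\<in>P. \<not> far b p"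
    by auto
  show ?case
  proof (cases "\<exists>p\<in>P. \<not> far x p")
    case True
    then show ?thesis using P by (intro exI[of _ P]) auto
  next
    case False
    then show ?thesis using P sym irr by (intro exI[of _ "insert x P"]) auto
  qed
qed simp

section \<open>Centre points from Helly's theorem\<close>

lemma sum_UN_le:
  fixes w :: "'a \<Rightarrow> real"
  assumes "finite I" and "\<And>i. i \<in> I \<Longrightarrow> finite (A i)" and w: "\<And>x. w x \<ge> 0"
  shows "sum w (\<Union>i\<in>I. A i) \<le> (\<Sum>i\<in>I. sum w (A i))"
  using assms(1,2)
proof (induction I rule: finite_induct)
  case (insert i I)
  let ?U = "\<Union>i\<in>I. A i"
  have "finite (A i)" "finite ?U" using insert by auto
  then have "sum w (A i \<union> ?U) + sum w (A i \<inter> ?U) = sum w (A i) + sum w ?U"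
    by (rule sum.union_inter)
  moreover have "sum w (A i \<inter> ?U) \<ge> 0" using w by (intro sum_nonneg)
  moreover have "sum w ?U \<le> (\<Sum>i\<in>I. sum w (A i))" using insert by auto
  ultimately show ?case using insert.hyps by simp
qed simp

text \<open>The complements of at most \<open>r\<close> such sets weigh less than \<open>X\<close>
  in total, so these sets meet and Helly's theorem applies. The weight stays unnormalised to suit
  later conditioning.\<close>

lemma ex_centre_point:
  fixes w :: "'a \<Rightarrow> real"
  assumes X: "finite X" and conv: "convexity_space X C" and rad: "radon_number X C \<le> r" "r \<ge> 1"
    and w: "\<And>x. w x \<ge> 0" and W: "sum w X > 0"
  shows "\<exists>p\<in>X. \<forall>c\<in>C. sum w c > (1 - 1 / r) * sum w X \<longrightarrow> p \<in> c"
proof -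
  define F where "F = {c\<in>C. sum w c > (1 - 1 / r) * sum w X}"
  have CX: "C \<subseteq> Pow X" using conv by (simp add: convexity_space_def)
  then have "finite C" using X finite_subset by blast
  then have finF: "finite F" by (simp add: F_def)
  have "X \<inter> \<Inter>F \<noteq> {}"
  proof (rule helly[OF X conv rad(1)])
    fix G assume G: "G \<subseteq> F" "card G \<le> r"
    have finG: "finite G" using G(1) finF by (rule finite_subset)
    show "X \<inter> \<Inter>G \<noteq> {}"
    proof (cases "G = {}")
      case True
      moreover have "X \<noteq> {}" using W by auto
      ultimately show ?thesis by simp
    next
      case False
      show ?thesis
      proof
        assume "X \<inter> \<Inter>G = {}"
        then have "X \<subseteq> (\<Union>c\<in>G. X - c)" by auto
        then have "sum w X \<le> sum w (\<Union>c\<in>G. X - c)"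
          using X finG w by (intro sum_mono2) auto
        also have "\<dots> \<le> (\<Sum>c\<in>G. sum w (X - c))"
          using X finG w by (intro sum_UN_le) auto
        also have "\<dots> < (\<Sum>c\<in>G. sum w X / r)"
        proof (rule sum_strict_mono[OF finG False])
          fix c assume "c \<in> G"
          then have "c \<subseteq> X" "sum w c > (1 - 1 / r) * sum w X" using G(1) CX by (auto simp: F_def)
          then show "sum w (X - c) < sum w X / r" using X by (simp add: sum_diff algebra_simps)
        qed
        also have "\<dots> = card G * (sum w X / r)" by simp
        also have "\<dots> \<le> r * (sum w X / r)" using G(2) W by (intro mult_right_mono) auto
        also have "\<dots> = sum w X" using rad(2) by simp
        finally show False by simp
      qed
    qed
  qed (use finF in \<open>auto simp: F_def\<close>)
  then show ?thesis by (auto simp: F_def)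
qed

section \<open>Construction of weak nets\<close>

text \<open>A set shattered by the halfspaces in \<open>P\<close> is Radon-shattered, because a
  halfspace and its complement are convex and so separate the two hulls. The \<open>+ 1\<close>
  leaves room for the centre point in \<open>ex_weighted_net\<close>.\<close>

lemma half_space_packing_bound:
  fixes w :: "'a \<Rightarrow> real" and r :: nat
  assumes X: "finite X" and CX: "C \<subseteq> Pow X" and rad: "radon_number X C \<le> r" "r \<ge> 1"
    and w: "\<And>x. w x \<ge> 0" and W: "sum w X > 0" and \<epsilon>: "0 < \<epsilon>" "\<epsilon> \<le> 1"
    and P: "\<And>b. b \<in> P \<Longrightarrow> half_space X C b"
    and far: "\<And>a b. a \<in> P \<Longrightarrow> b \<in> P \<Longrightarrow> a \<noteq> b \<Longrightarrow>
       sum w ((a - b) \<union> (b - a)) \<ge> \<epsilon> / (8 * r) * sum w X"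
  shows "real (card P) + 1 \<le> (120 * real r ^ 2 / \<epsilon>) ^ (2 * r)"
proof (cases "P = {}")
  case True
  have "1 * 1 \<le> (120 * real r ^ 2) * (1 / \<epsilon>)"
  proof (rule mult_mono)
    have "1 \<le> real r ^ 2" using rad(2) by simp
    then show "1 \<le> 120 * real r ^ 2" by linarith
  qed (use \<epsilon> in auto)
  then show ?thesis using True by (simp add: one_le_power)
next
  case False
  have PX: "P \<subseteq> Pow X" using P CX by (auto simp: half_space_def)
  have vc: "card Z \<le> r" if Z: "Z \<subseteq> X" "vc_shatters P Z" for Z
  proof -
    have "radon_shatters C Z"
      unfolding radon_shatters_def
    proof (intro allI impI)
      fix Y1 Y2 assume Y: "Y1 \<union> Y2 = Z \<and> Y1 \<inter> Y2 = {}"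
      then have "Y1 \<subseteq> Z" by auto
      from Z(2)[unfolded vc_shatters_def, rule_format, OF this]
      obtain b where b: "b \<in> P" "b \<inter> Z = Y1" by blast
      have "Y1 \<subseteq> b" "Y2 \<subseteq> X - b" using b(2) Y Z(1) by auto
      then have "cconv C Y1 \<subseteq> b" "cconv C Y2 \<subseteq> X - b"
        using P[OF b(1)] by (auto simp: half_space_def intro!: cconv_subset del: subsetI)
      then show "cconv C Y1 \<inter> cconv C Y2 = {}" by auto
    qed
    then show ?thesis using radon_shatters_card_less[OF X Z(1)] rad(1) by fastforce
  qed
  have "real (card P) \<le> (2 + 2 * ln (card P) / (\<epsilon> / (8 * r))) ^ r"
  proof (rule packing_bound[OF X w W _ PX False])
    show "0 < \<epsilon> / (8 * r)" using rad(2) \<epsilon> by simp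
    show "\<epsilon> / (8 * r) * sum w X \<le> sum w ((a - b) \<union> (b - a))" if "a \<in> P" "b \<in> P" "a \<noteq> b" for a b
      using that by (rule far)
    show "card Z \<le> r" if "Z \<subseteq> X" "vc_shatters P Z" for Z
      using that by (rule vc)
  qed
  moreover have "card P \<ge> 1"
    using False PX X by (metis One_nat_def Suc_leI card_gt_0_iff finite_Pow_iff finite_subset)
  ultimately show ?thesis using rad(2) \<epsilon> by (intro packing_size_arith)
qed

text \<open>The gain from conditioning: a halfspace of relative weight at most
  \<open>1 - 1 / r\<close> concentrates a set inside it, and approximating the halfspace costs
  relative errors of \<open>1 / (8 * r)\<close> on both sides. With \<open>x = 1 / (2 * r)\<close>,
  use \<open>1 - 2 * x \<le> exp (- 2 * x)\<close> and \<open>exp x \<ge> 1 + x\<close>.\<close>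

lemma growth_arith:
  fixes r :: nat
  assumes "r \<ge> 1"
  shows "exp (1 / (2 * r)) * ((1 - 1 / r) * (1 + 1 / (8 * r))) \<le> 1 - 1 / (8 * r)"
proof -
  define x where "x = 1 / (2 * real r)"
  have x: "0 < x" "x \<le> 1 / 2" using assms by (simp_all add: x_def field_simps)
  have eqs: "1 / real r = 2 * x" "1 / real (8 * r) = x / 4" "1 / real (2 * r) = x" by (simp_all add: x_def)
  have "exp x * (1 - 2 * x) \<le> exp x * exp (- (2 * x))"
    using exp_ge_add_one_self[of "- (2 * x)"] by (intro mult_left_mono) auto
  also have "\<dots> = 1 / exp x" by (simp add: exp_minus[symmetric] exp_add[symmetric] inverse_eq_divide[symmetric])
  also have "\<dots> \<le> 1 / (1 + x)" using x by (intro divide_left_mono) auto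
  finally have "exp x * (1 - 2 * x) * (1 + x / 4) \<le> 1 / (1 + x) * (1 + x / 4)"
    using x by (intro mult_right_mono) auto
  also have "\<dots> \<le> 1 - x / 4"
  proof -
    have "x * x \<le> 1 * x" using x by (intro mult_right_mono) auto
    moreover have "(1 - x / 4) * (1 + x) = 1 + 3 / 4 * x - x * x / 4" by (simp add: field_simps)
    ultimately have "1 + x / 4 \<le> (1 - x / 4) * (1 + x)" using x by linarith
    then show ?thesis using x by (simp add: pos_divide_le_eq)
  qed
  finally show ?thesis unfolding eqs by (simp add: mult.assoc)
qed

text \<open>\<open>\<epsilon>\<close> grows along the recursion, while the packing resolution and
  hence the branching depend only on the initial \<open>\<epsilon>0\<close>. By \<open>big\<close>,
  after \<open>k\<close> gains of \<open>exp (1 / (2 * r))\<close> the threshold exceeds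
  \<open>1 - 1 / r\<close>, where a centre point alone is a net.\<close>

lemma ex_weighted_net:
  fixes w :: "'a \<Rightarrow> real" and r k :: nat
  assumes X: "finite X" and conv: "convexity_space X C" and sep: "separable X C"
    and rad: "radon_number X C \<le> r" "r \<ge> 1" and \<epsilon>0: "0 < \<epsilon>0" "\<epsilon>0 \<le> 1"
    and w: "\<And>x. w x \<ge> 0" and W: "sum w X > 0" and \<epsilon>: "\<epsilon>0 \<le> \<epsilon>"
    and big: "1 - 1 / r < \<epsilon> * exp (k / (2 * r))"
  shows "\<exists>S\<subseteq>X. real (card S) \<le> ((120 * real r ^ 2 / \<epsilon>0) ^ (2 * r)) ^ k
     \<and> (\<forall>c\<in>C. sum w c \<ge> \<epsilon> * sum w X \<longrightarrow> S \<inter> c \<noteq> {})"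
  using w W \<epsilon> big
proof (induction k arbitrary: w \<epsilon>)
  case 0
  obtain p where p: "p \<in> X" "\<And>c. c \<in> C \<Longrightarrow> sum w c > (1 - 1 / r) * sum w X \<Longrightarrow> p \<in> c"
    using ex_centre_point[OF X conv rad, of w] 0 by blast
  have "(1 - 1 / r) * sum w X < \<epsilon> * sum w X"
    using 0 by (intro mult_strict_right_mono) auto
  then have "\<forall>c\<in>C. sum w c \<ge> \<epsilon> * sum w X \<longrightarrow> {p} \<inter> c \<noteq> {}" using p(2) by fastforce
  then show ?case using p(1) by (intro exI[of _ "{p}"]) simp
next
  case (Suc k)
  note w = Suc.prems(1) and W = Suc.prems(2) and \<epsilon> = Suc.prems(3)
  let ?W = "sum w X"
  define Q where "Q = (120 * real r ^ 2 / \<epsilon>0) ^ (2 * r)"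
  define t where "t = 1 - 1 / real r"
  define \<eta> where "\<eta> = 1 / (8 * real r)"
  define g where "g = exp (1 / (2 * real r))"
  have pos: "0 < \<eta>" "\<eta> \<le> 1 / 8" "0 \<le> t" "g \<ge> 1"
    using rad(2) by (simp_all add: \<eta>_def t_def g_def)
  have CX: "C \<subseteq> Pow X" using conv by (simp add: convexity_space_def)
  then have finC: "finite C" using X finite_subset by blast
  have fin: "finite c" if "c \<in> C" for c using that CX X finite_subset by blast
  obtain p where p: "p \<in> X" "\<And>c. c \<in> C \<Longrightarrow> sum w c > t * ?W \<Longrightarrow> p \<in> c"
    using ex_centre_point[OF X conv rad, of w] w W unfolding t_def by blast
  define B where "B = {b. half_space X C b}"
  have BC: "B \<subseteq> C" by (auto simp: B_def half_space_def)
  then have "finite B" using finC finite_subset by blast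
  define far where "far a b \<longleftrightarrow> sum w ((a - b) \<union> (b - a)) \<ge> \<epsilon>0 / (8 * r) * ?W" for a b
  have pos_thr: "\<epsilon>0 / (8 * r) * ?W > 0" using \<epsilon>0 rad(2) W by simp
  have far_sym: "far b a" if "far a b" for a b using that by (simp add: far_def Un_commute)
  have far_irr: "\<not> far a a" for a using pos_thr by (simp add: far_def)
  obtain P where P: "P \<subseteq> B" "\<forall>a\<in>P. \<forall>b\<in>P. a \<noteq> b \<longrightarrow> far a b"
      "\<forall>b\<in>B. \<exists>b'\<in>P. \<not> far b b'"
    using ex_maximal_packing[OF \<open>finite B\<close>, of far, OF far_sym far_irr] by blast
  have finP: "finite P" using P(1) \<open>finite B\<close> finite_subset by blast
  have Q: "real (card P) + 1 \<le> Q"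
    unfolding Q_def
  proof (rule half_space_packing_bound[OF X CX rad w W \<epsilon>0])
    show "half_space X C b" if "b \<in> P" for b using that P(1) by (auto simp: B_def)
    show "\<epsilon>0 / (8 * r) * ?W \<le> sum w ((a - b) \<union> (b - a))" if "a \<in> P" "b \<in> P" "a \<noteq> b" for a b
      using P(2) that unfolding far_def by blast
  qed
  then have Q1: "Q \<ge> 1" by simp
  have eps: "\<epsilon> > 0" using \<epsilon> \<epsilon>0 by simp
  have "\<exists>S\<subseteq>X. real (card S) \<le> Q ^ k \<and>
      (\<forall>c\<in>C. sum w (c \<inter> b) \<ge> \<epsilon> * g * sum w b \<and> sum w b > 0 \<longrightarrow> S \<inter> c \<noteq> {})" if b: "b \<in> P" for b
  proof (cases "sum w b > 0")
    case True
    \<comment> \<open>Conditioning on \<open>b\<close> without normalising: weights outside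
      \<open>b\<close> become zero.\<close>
    define v where "v x = (if x \<in> b then w x else 0)" for x
    have v: "sum v c = sum w (c \<inter> b)" if "finite c" for c
      using sum.inter_restrict[OF that, of w b] by (simp add: v_def)
    have bX: "X \<inter> b = b" using b P(1) BC CX by auto
    have vX: "sum v X = sum w b" using v[OF X] bX by simp
    have "\<exists>S\<subseteq>X. real (card S) \<le> Q ^ k \<and> (\<forall>c\<in>C. sum v c \<ge> (\<epsilon> * g) * sum v X \<longrightarrow> S \<inter> c \<noteq> {})"
      unfolding Q_def
    proof (rule Suc.IH)
      show "0 \<le> v x" for x using w by (simp add: v_def)
      show "0 < sum v X" using vX True by simp
      have "\<epsilon> * 1 \<le> \<epsilon> * g" using eps pos by (intro mult_left_mono) auto
      then show "\<epsilon>0 \<le> \<epsilon> * g" using \<epsilon> by simp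
      have "g * exp (k / (2 * r)) = exp (Suc k / (2 * r))"
        by (simp add: g_def exp_add[symmetric] add_divide_distrib)
      then show "1 - 1 / r < \<epsilon> * g * exp (k / (2 * r))" using Suc.prems(4) by (simp add: mult.assoc)
    qed
    then obtain S where S: "S \<subseteq> X" "real (card S) \<le> Q ^ k"
        "\<forall>c\<in>C. sum v c \<ge> (\<epsilon> * g) * sum v X \<longrightarrow> S \<inter> c \<noteq> {}"
      by blast
    have "S \<inter> c \<noteq> {}" if "c \<in> C" "sum w (c \<inter> b) \<ge> \<epsilon> * g * sum w b" for c
      using S(3) that v[OF fin[OF that(1)]] vX by simp
    then show ?thesis using S(1,2) by blast
  next
    case False
    then show ?thesis using Q1 by (intro exI[of _ "{}"]) simp
  qed
  then have "\<forall>b\<in>P. \<exists>S\<subseteq>X. real (card S) \<le> Q ^ k \<and>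
      (\<forall>c\<in>C. sum w (c \<inter> b) \<ge> \<epsilon> * g * sum w b \<and> sum w b > 0 \<longrightarrow> S \<inter> c \<noteq> {})" by blast
  from bchoice[OF this] obtain S where S: "\<forall>b\<in>P. S b \<subseteq> X" "\<forall>b\<in>P. real (card (S b)) \<le> Q ^ k"
      "\<forall>b\<in>P. \<forall>c\<in>C. sum w (c \<inter> b) \<ge> \<epsilon> * g * sum w b \<and> sum w b > 0 \<longrightarrow> S b \<inter> c \<noteq> {}"
    by blast
  define T where "T = insert p (\<Union>b\<in>P. S b)"
  have "T \<subseteq> X" using p(1) S(1) by (auto simp: T_def)
  have "real (card T) \<le> 1 + real (card (\<Union>b\<in>P. S b))"
    unfolding T_def using card_insert_le_m1[of "Suc (card (\<Union>b\<in>P. S b))" _ p] by fastforce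
  also have "real (card (\<Union>b\<in>P. S b)) \<le> (\<Sum>b\<in>P. real (card (S b)))"
    using card_UN_le[OF finP, of S] by (metis of_nat_le_iff of_nat_sum)
  also have "\<dots> \<le> (\<Sum>b\<in>P. Q ^ k)" using S(2) by (intro sum_mono) blast
  \<comment> \<open>The centre point is counted generously, as one more net of size
    \<open>Q ^ k\<close>.\<close>
  also have "1 + \<dots> \<le> (real (card P) + 1) * Q ^ k" using one_le_power[OF Q1, of k] by (simp add: algebra_simps)
  also have "\<dots> \<le> Q * Q ^ k" using Q Q1 by (intro mult_right_mono) auto
  finally have cardT: "real (card T) \<le> Q ^ Suc k" by simp
  have "T \<inter> c \<noteq> {}" if c: "c \<in> C" "sum w c \<ge> \<epsilon> * ?W" for c
  proof (cases "p \<in> c")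
    case True
    then show ?thesis by (auto simp: T_def)
  next
    case False
    then obtain b where b: "half_space X C b" "c \<subseteq> b" "p \<notin> b"
      using sep[unfolded separable_def, rule_format, OF c(1), of p] p(1) by blast
    then have bB: "b \<in> B" "b \<in> C" by (auto simp: B_def half_space_def)
    have wb: "sum w b \<le> t * ?W" using p(2)[OF bB(2)] b(3) by fastforce
    obtain b' where b': "b' \<in> P" "\<not> far b b'" using P(3) bB(1) by blast
    have b'C: "b' \<in> C" using b'(1) P(1) BC by auto
    have "\<epsilon>0 / (8 * r) * ?W = \<eta> * \<epsilon>0 * ?W" by (simp add: \<eta>_def)
    also have "\<dots> \<le> \<eta> * \<epsilon> * ?W" using \<epsilon> pos W by (intro mult_right_mono mult_left_mono) auto
    finally have close: "sum w ((b - b') \<union> (b' - b)) \<le> \<eta> * \<epsilon> * ?W" using b'(2) by (simp add: far_def)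
    have fins: "finite b" "finite b'" "finite c" using fin bB(2) b'C c(1) by auto
    have "sum w (b - b') \<le> sum w ((b - b') \<union> (b' - b))" "sum w (b' - b) \<le> sum w ((b - b') \<union> (b' - b))"
      using fins w by (auto intro!: sum_mono2)
    then have diffs: "sum w (b - b') \<le> \<eta> * \<epsilon> * ?W" "sum w (b' - b) \<le> \<eta> * \<epsilon> * ?W" using close by auto
    have "sum w c \<le> sum w b" using fins b(2) w by (intro sum_mono2) auto
    then have "\<epsilon> * ?W \<le> t * ?W" using c(2) wb by linarith
    \<comment> \<open>This turns the additive error \<open>\<eta> * \<epsilon> * ?W\<close> in the
      weight of \<open>b'\<close> into a factor \<open>1 + \<eta>\<close> on
      \<open>t\<close>.\<close>
    then have \<epsilon>t: "\<epsilon> \<le> t" using W by simp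
    have "sum w b' = sum w (b' \<inter> b) + sum w (b' - b)"
      using sum.Int_Diff[OF fins(2), of w b] .
    also have "sum w (b' \<inter> b) \<le> sum w b" using fins w by (intro sum_mono2) auto
    also have "sum w b + sum w (b' - b) \<le> t * ?W + \<eta> * \<epsilon> * ?W" using wb diffs by simp
    also have "\<dots> \<le> t * ?W + \<eta> * t * ?W"
      using \<epsilon>t pos W by (intro add_left_mono mult_right_mono mult_left_mono) auto
    finally have wb': "sum w b' \<le> t * (1 + \<eta>) * ?W" by (simp add: algebra_simps)
    have "sum w c = sum w (c \<inter> b') + sum w (c - b')"
      using sum.Int_Diff[OF fins(3), of w b'] .
    moreover have "sum w (c - b') \<le> sum w (b - b')" using fins b(2) w by (intro sum_mono2) auto
    ultimately have wc: "sum w (c \<inter> b') \<ge> (1 - \<eta>) * \<epsilon> * ?W"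
      using diffs c(2) by (simp add: algebra_simps)
    have "g * (t * (1 + \<eta>)) \<le> 1 - \<eta>"
      using growth_arith[OF rad(2)] by (simp add: g_def t_def \<eta>_def)
    then have "g * (t * (1 + \<eta>)) * (\<epsilon> * ?W) \<le> (1 - \<eta>) * (\<epsilon> * ?W)"
      using eps W by (intro mult_right_mono) auto
    moreover have "\<epsilon> * g * sum w b' \<le> \<epsilon> * g * (t * (1 + \<eta>) * ?W)"
      using wb' eps pos by (intro mult_left_mono) auto
    ultimately have "\<epsilon> * g * sum w b' \<le> sum w (c \<inter> b')"
      using wc by (simp add: algebra_simps)
    moreover have "sum w b' > 0"
    proof -
      have "0 < (1 - \<eta>) * \<epsilon> * ?W" using pos eps W by (intro mult_pos_pos) auto
      also have "\<dots> \<le> sum w (c \<inter> b')" by (rule wc)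
      also have "\<dots> \<le> sum w b'" using fins w by (intro sum_mono2) auto
      finally show ?thesis .
    qed
    ultimately have "S b' \<inter> c \<noteq> {}" using S(3) b'(1) c(1) by blast
    then show ?thesis using b'(1) by (auto simp: T_def)
  qed
  then show ?case using \<open>T \<subseteq> X\<close> cardT unfolding Q_def by blast
qed

lemma ex_weak_eps_net:
  fixes \<mu> :: "'a pmf" and r :: nat
  assumes X: "finite X" and conv: "convexity_space X C" and sep: "separable X C"
    and rad: "radon_number X C \<le> r" and \<epsilon>: "0 < \<epsilon>" and \<mu>: "set_pmf \<mu> \<subseteq> X"
  shows "\<exists>S. weak_eps_net X C \<mu> \<epsilon> S \<and>
    real (card S) \<le> (120 * real r ^ 2 / \<epsilon>) powr (4 * real r ^ 2 * ln (1 / \<epsilon>))"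
proof (cases "\<epsilon> \<le> 1")
  \<comment> \<open>A threshold above 1 is met by no set, so the empty net works.\<close>
  case False
  have "\<not> measure_pmf.prob \<mu> c \<ge> \<epsilon>" for c
    using False measure_pmf.prob_le_1[of \<mu> c] by linarith
  then have "weak_eps_net X C \<mu> \<epsilon> {}" by (simp add: weak_eps_net_def)
  then show ?thesis by (intro exI[of _ "{}"]) simp
next
  case True
  have r: "r \<ge> 1" using radon_number_pos[OF X conv] rad by simp
  \<comment> \<open>Rounding down keeps the exponent \<open>2 * r * k\<close> at most
    \<open>4 * r ^ 2 * ln (1 / \<epsilon>)\<close>; the fraction of a step that is lost is covered
    by \<open>1 - 1 / r < exp (- 1 / (2 * r))\<close>.\<close>
  define k where "k = nat \<lfloor>2 * r * ln (1 / \<epsilon>)\<rfloor>"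
  define A where "A = 120 * real r ^ 2 / \<epsilon>"
  have ln: "ln (1 / \<epsilon>) \<ge> 0" using \<epsilon> True by simp
  have k: "real k \<le> 2 * r * ln (1 / \<epsilon>)" "real k + 1 > 2 * r * ln (1 / \<epsilon>)"
    using ln by (auto simp: k_def)
  have one: "sum (pmf \<mu>) X = 1" using X \<mu> by (rule sum_pmf_eq_1)
  have "1 - 1 / r < \<epsilon> * exp (k / (2 * r))"
  proof -
    have "ln (1 / \<epsilon>) - 1 / (2 * r) < k / (2 * r)"
    proof -
      have "(2 * r * ln (1 / \<epsilon>) - 1) / (2 * r) < k / (2 * r)"
        using k(2) r by (intro divide_strict_right_mono) auto
      then show ?thesis using r by (simp add: diff_divide_distrib)
    qed
    then have "exp (ln (1 / \<epsilon>) - 1 / (2 * r)) < exp (k / (2 * r))" by simp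
    then have "exp (- (1 / (2 * r))) < \<epsilon> * exp (k / (2 * r))"
      using \<epsilon> by (simp add: exp_diff exp_minus field_simps ln_div)
    moreover have "1 - 1 / (2 * r) \<le> exp (- (1 / (2 * r)))"
      using exp_ge_add_one_self[of "- (1 / (2 * real r))"] by simp
    moreover have "1 - 1 / r < 1 - 1 / (2 * r)" using r by (simp add: field_simps)
    ultimately show ?thesis by linarith
  qed
  then obtain S where S: "S \<subseteq> X" "real (card S) \<le> (A ^ (2 * r)) ^ k"
      "\<And>c. c \<in> C \<Longrightarrow> sum (pmf \<mu>) c \<ge> \<epsilon> \<Longrightarrow> S \<inter> c \<noteq> {}"
    using ex_weighted_net[OF X conv sep rad r \<epsilon> True, of "pmf \<mu>" \<epsilon> k] one unfolding A_def by auto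
  have "weak_eps_net X C \<mu> \<epsilon> S"
    unfolding weak_eps_net_def
  proof (intro conjI ballI impI)
    fix c assume c: "c \<in> C" "\<epsilon> \<le> measure_pmf.prob \<mu> c"
    have "finite c" using c(1) conv X finite_subset by (auto simp: convexity_space_def)
    then have "sum (pmf \<mu>) c \<ge> \<epsilon>" using c(2) by (simp add: measure_measure_pmf_finite)
    then show "S \<inter> c \<noteq> {}" by (rule S(3)[OF c(1)])
  qed (rule S(1))
  moreover have "(A ^ (2 * r)) ^ k \<le> A powr (4 * real r ^ 2 * ln (1 / \<epsilon>))"
  proof -
    have A: "A \<ge> 1"
    proof -
      have "1 \<le> real r ^ 2" using r by simp
      then have "\<epsilon> \<le> 120 * real r ^ 2" using True by linarith
      then show ?thesis using \<epsilon> by (simp add: A_def)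
    qed
    have "(A ^ (2 * r)) ^ k = A powr (real (2 * r * k))"
      using A by (subst powr_realpow) (auto simp: power_mult)
    also have "\<dots> \<le> A powr (4 * real r ^ 2 * ln (1 / \<epsilon>))"
    proof (rule powr_mono[OF _ A])
      have "real (2 * r * k) = 2 * r * real k" by simp
      also have "\<dots> \<le> 2 * r * (2 * r * ln (1 / \<epsilon>))" using k(1) by (intro mult_left_mono) auto
      finally show "real (2 * r * k) \<le> 4 * real r ^ 2 * ln (1 / \<epsilon>)" by (simp add: power2_eq_square)
    qed
    finally show ?thesis .
  qed
  ultimately show ?thesis using S(2) unfolding A_def by force
qed

section \<open>The two bounds on the size of weak nets\<close>

theorem theorem2:
  fixes X :: "'a set" and C :: "'a set set"
  assumes "finite X" and "convexity_space X C" and "separable X C"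
  shows "(\<forall>(r::nat) (\<epsilon>::real) (\<mu>::'a pmf).
            radon_number X C \<le> r \<and> \<epsilon> > 0 \<and> set_pmf \<mu> \<subseteq> X \<longrightarrow>
            (\<exists>S. weak_eps_net X C \<mu> \<epsilon> S \<and>
                 real (card S) \<le> (120 * real r ^ 2 / \<epsilon>) powr (4 * real r ^ 2 * ln (1 / \<epsilon>))))
       \<and> (\<forall>r::nat. radon_number X C > r \<and> X \<noteq> {} \<longrightarrow>
            (\<exists>\<mu>::'a pmf. set_pmf \<mu> \<subseteq> X \<and>
               (\<forall>S. weak_eps_net X C \<mu> (1/4) S \<longrightarrow> real (card S) \<ge> real r / 2)))"
proof (intro conjI allI impI)
  fix r :: nat and \<epsilon> :: real and \<mu> :: "'a pmf"
  assume "radon_number X C \<le> r \<and> \<epsilon> > 0 \<and> set_pmf \<mu> \<subseteq> X"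
  then show "\<exists>S. weak_eps_net X C \<mu> \<epsilon> S \<and>
      real (card S) \<le> (120 * real r ^ 2 / \<epsilon>) powr (4 * real r ^ 2 * ln (1 / \<epsilon>))"
    using ex_weak_eps_net[OF assms] by blast
next
  fix r :: nat
  assume r: "radon_number X C > r \<and> X \<noteq> {}"
  show "\<exists>\<mu>. set_pmf \<mu> \<subseteq> X \<and> (\<forall>S. weak_eps_net X C \<mu> (1/4) S \<longrightarrow> real (card S) \<ge> real r / 2)"
  proof (cases "r = 0")
    \<comment> \<open>The empty set carries no uniform distribution, but for \<open>r = 0\<close>
      any point mass will do; this is where \<open>X \<noteq> {}\<close> enters.\<close>
    case True
    obtain x where "x \<in> X" using r by blast
    then show ?thesis using True by (intro exI[of _ "return_pmf x"]) simp
  next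
    case False
    obtain Y where Y: "Y \<subseteq> X" "finite Y" "card Y = r" "radon_shatters C Y"
      using ex_radon_shatters r by blast
    then have "Y \<noteq> {}" using False by auto
    then show ?thesis
      using Y weak_quarter_net_bound[OF assms(1,2) Y(4,1)]
      by (intro exI[of _ "pmf_of_set Y"]) (simp add: set_pmf_of_set)
  qed
qed

end
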